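(* Let $p,q$ be positive integers, let $X$ be an $n$-dimensional complex manifold on which one can define a global $\mathcal{C}^2$-smooth real valued function whose complex Hessian has at each point at least $n-p+1$ positive eigenvalues, and let $A$ be a set-theoretically weakly $q$-pseudoconcave locally closed subset of $X$. If $q\ge p$, then the maximum modulus principle for LACR functions holds on $A$. This means that, for every relatively compact domain $D\Subset A$, $$\max_{x\in\overline D}|u(x)|=\max_{x\in\partial_A D}|u(x)|\qquad\text{for all } u\in\tilde{\mathscr{O}}_A(D)\cap\mathcal{C}(\overline D).$$
   Context: Domains $D$ are taken in the subspace topology of $A$; $\partial_A D$ is the boundary of $D$ in $A$ and $\overline D$ its closure. Pseudoconcavity. Let $X$ be an $n$-dimensional complex manifold, $A\subseteq X$ locally closed, $x\in A$. $A$ is set-theoretically $q$-pseudoconvex at $x$ if there are an open neighbourhood $\omega$ of $x$ in $X$ and $\varphi\in\mathcal{C}^\infty(\omega,\mathbb{R})$ such that $A\cap\omega\subseteq\{\varphi\le\varphi(x)\}$ and the complex Hessian $(\partial^2\varphi/\partial z_i\partial\bar z_j)$ at $x$ has at least $n-q+1$ positive eigenvalues. $A$ is set-theoretically weakly $q$-pseudoconcave if it is not set-theoretically $q$-pseudoconvex at any of its points. LACR functions. $\mathcal{C}_A$ is the sheaf of germs of continuous complex valued functions on $A$. $\mathscr{O}_A\subseteq\mathcal{C}_A$ is the subsheaf of germs of functions that are, near each point, restrictions to $A$ of holomorphic functions on open subsets of $X$. For a set $\mathcal{H}$ of germs of continuous functions on $A$ and $U$ open in $A$, $\mathcal{H}(U)$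 is the set of continuous functions on $U$ all of whose germs belong to $\mathcal{H}$; $\mathcal{H}^c$ is the set of germs $f_{(x)}$ having, on some open neighbourhood $U_x$ of $x$ in $A$, a representative which is the limit, uniformly on compact subsets of $U_x$, of a sequence in $\mathcal{H}(U_x)$. $\mathcal{H}^{(c)}$ is the smallest set of germs that contains $\mathcal{H}$ and is stable under the operation $\mathcal{H}\mapsto\mathcal{H}^c$. The sheaf of LACR (locally approximable continuous CR) functions is $\tilde{\mathscr{O}}_A=\mathscr{O}_A^{(c)}$. *)

theory Defs
  imports "HOL-Analysis.Analysis"
begin

section \<open>Holomorphy and differentiability classes on open subsets of complex n-space\<close>

text \<open>Complex n-space is \<^typ>\<open>complex ^ 'n\<close> with \<open>n = CARD('n)\<close>. Both predicates below are
  meant for open \<open>S\<close> only.\<close>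

definition holomorphic_Cn :: "(complex ^ 'n \<Rightarrow> complex) \<Rightarrow> (complex ^ 'n) set \<Rightarrow> bool" where
  "holomorphic_Cn f S \<longleftrightarrow>
     (\<forall>z\<in>S. \<exists>f'. (f has_derivative f') (at z) \<and> (\<forall>c v. f' (c *s v) = c * f' v))"

fun Ck_on :: "nat \<Rightarrow> ('a::real_normed_vector \<Rightarrow> 'b::real_normed_vector) \<Rightarrow> 'a set \<Rightarrow> bool" where
  "Ck_on 0 f S \<longleftrightarrow> continuous_on S f"
| "Ck_on (Suc k) f S \<longleftrightarrow>
     (\<forall>x\<in>S. f differentiable (at x)) \<and>
     (\<forall>v. Ck_on k (\<lambda>x. frechet_derivative f (at x) v) S)"


section \<open>The complex Hessian and its positive eigenvalues\<close>

text \<open>The Wirtinger operators: \<open>axis i 1\<close> and \<open>axis i \<i>\<close> are the real coordinate directions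
  \<open>x\<^sub>i\<close> and \<open>y\<^sub>i\<close> of \<open>z\<^sub>i = x\<^sub>i + \<i> y\<^sub>i\<close>.\<close>

definition d_z :: "'n \<Rightarrow> (complex ^ 'n \<Rightarrow> complex) \<Rightarrow> complex ^ 'n \<Rightarrow> complex" where
  "d_z i f z = (frechet_derivative f (at z) (axis i 1)
                - \<i> * frechet_derivative f (at z) (axis i \<i>)) / 2"

definition d_zbar :: "'n \<Rightarrow> (complex ^ 'n \<Rightarrow> complex) \<Rightarrow> complex ^ 'n \<Rightarrow> complex" where
  "d_zbar i f z = (frechet_derivative f (at z) (axis i 1)
                   + \<i> * frechet_derivative f (at z) (axis i \<i>)) / 2"

definition complex_hessian ::
    "(complex ^ 'n \<Rightarrow> real) \<Rightarrow> complex ^ 'n \<Rightarrow> complex ^ 'n ^ 'n" where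
  "complex_hessian f z = (\<chi> i j. d_z i (d_zbar j (\<lambda>w. complex_of_real (f w))) z)"

definition eigenspace :: "complex ^ 'n ^ 'n \<Rightarrow> complex \<Rightarrow> (complex ^ 'n) set" where
  "eigenspace H c = {v. H *v v = c *s v}"

text \<open>Eigenvalues are counted with multiplicity. The matrices in question are Hermitian, so the
  multiplicity is the complex dimension of the eigenspace.\<close>

definition num_pos_eigenvalues :: "complex ^ 'n ^ 'n \<Rightarrow> nat" where
  "num_pos_eigenvalues H =
     (\<Sum>c\<in>{c::real. c > 0 \<and> (\<exists>v\<in>eigenspace H (of_real c). v \<noteq> 0)}.
        vec.dim (eigenspace H (of_real c)))"


section \<open>Complex manifolds\<close>

text \<open>A chart is a pair \<open>(U, z)\<close> of a domain and a coordinate map. Functions defined on a subset of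
  the manifold are represented by total functions, whose values elsewhere are irrelevant.\<close>

type_synonym ('a, 'n) chart = "'a set \<times> ('a \<Rightarrow> complex ^ 'n)"

definition complex_manifold :: "'a topology \<Rightarrow> ('a, 'n::finite) chart set \<Rightarrow> bool" where
  "complex_manifold X \<A> \<longleftrightarrow>
     Hausdorff_space X \<and> second_countable X \<and>
     topspace X = (\<Union>(U, z)\<in>\<A>. U) \<and>
     (\<forall>(U, z)\<in>\<A>. openin X U \<and> open (z ` U) \<and>
        homeomorphic_map (subtopology X U) (top_of_set (z ` U)) z) \<and>
     (\<forall>(U, z)\<in>\<A>. \<forall>(V, w)\<in>\<A>. \<forall>i.
        holomorphic_Cn (\<lambda>\<zeta>. w (inv_into U z \<zeta>) $ i) (z ` (U \<inter> V)))"

definition holomorphic_fun_on ::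
    "('a, 'n::finite) chart set \<Rightarrow> 'a set \<Rightarrow> ('a \<Rightarrow> complex) \<Rightarrow> bool" where
  "holomorphic_fun_on \<A> V f \<longleftrightarrow>
     (\<forall>(U, z)\<in>\<A>. holomorphic_Cn (f \<circ> inv_into U z) (z ` (U \<inter> V)))"

definition Ck_fun_on ::
    "('a, 'n::finite) chart set \<Rightarrow> nat \<Rightarrow> 'a set \<Rightarrow> ('a \<Rightarrow> real) \<Rightarrow> bool" where
  "Ck_fun_on \<A> k V f \<longleftrightarrow> (\<forall>(U, z)\<in>\<A>. Ck_on k (f \<circ> inv_into U z) (z ` (U \<inter> V)))"

definition smooth_fun_on ::
    "('a, 'n::finite) chart set \<Rightarrow> 'a set \<Rightarrow> ('a \<Rightarrow> real) \<Rightarrow> bool" where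
  "smooth_fun_on \<A> V f \<longleftrightarrow> (\<forall>k. Ck_fun_on \<A> k V f)"

text \<open>A holomorphic change of coordinates transforms the complex Hessian by congruence with the
  Jacobian, so the number of positive eigenvalues does not depend on the chart around \<open>x\<close>. The bound
  \<open>m\<close> is an integer because \<open>n - q + 1\<close> may be negative, in which case there is no condition.\<close>

definition hessian_pos_eigenvalues_ge ::
    "('a, 'n::finite) chart set \<Rightarrow> ('a \<Rightarrow> real) \<Rightarrow> 'a \<Rightarrow> int \<Rightarrow> bool" where
  "hessian_pos_eigenvalues_ge \<A> f x m \<longleftrightarrow>
     (\<exists>(U, z)\<in>\<A>. x \<in> U \<and>
        int (num_pos_eigenvalues (complex_hessian (f \<circ> inv_into U z) (z x))) \<ge> m)"


section \<open>Set-theoretical pseudoconcavity\<close>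

definition locally_closed_in :: "'a topology \<Rightarrow> 'a set \<Rightarrow> bool" where
  "locally_closed_in X A \<longleftrightarrow> (\<exists>U C. openin X U \<and> closedin X C \<and> A = U \<inter> C)"

definition set_pseudoconvex_at ::
    "'a topology \<Rightarrow> ('a, 'n::finite) chart set \<Rightarrow> nat \<Rightarrow> 'a set \<Rightarrow> 'a \<Rightarrow> bool" where
  "set_pseudoconvex_at X \<A> q A x \<longleftrightarrow>
     (\<exists>\<omega> \<phi>. openin X \<omega> \<and> x \<in> \<omega> \<and> smooth_fun_on \<A> \<omega> \<phi> \<and>
        A \<inter> \<omega> \<subseteq> {y. \<phi> y \<le> \<phi> x} \<and>
        hessian_pos_eigenvalues_ge \<A> \<phi> x (int CARD('n) - int q + 1))"

definition set_weakly_pseudoconcave ::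
    "'a topology \<Rightarrow> ('a, 'n::finite) chart set \<Rightarrow> nat \<Rightarrow> 'a set \<Rightarrow> bool" where
  "set_weakly_pseudoconcave X \<A> q A \<longleftrightarrow> (\<forall>x\<in>A. \<not> set_pseudoconvex_at X \<A> q A x)"


section \<open>Germs and LACR functions\<close>

text \<open>In the following \<open>T\<close> is the subspace topology of \<open>A\<close>. A germ at \<open>x\<close> is the point \<open>x\<close> together
  with the class of all functions that agree with a given one near \<open>x\<close>.\<close>

type_synonym 'a germ = "'a \<times> ('a \<Rightarrow> complex) set"

definition germ_at :: "'a topology \<Rightarrow> 'a \<Rightarrow> ('a \<Rightarrow> complex) \<Rightarrow> 'a germ" where
  "germ_at T x f = (x, {g. \<exists>U. openin T U \<and> x \<in> U \<and> (\<forall>y\<in>U. g y = f y)})"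

definition continuous_germs :: "'a topology \<Rightarrow> 'a germ set" where
  "continuous_germs T =
     {germ_at T x f | x f. \<exists>U. openin T U \<and> x \<in> U \<and> continuous_map (subtopology T U) euclidean f}"

definition sections :: "'a topology \<Rightarrow> 'a germ set \<Rightarrow> 'a set \<Rightarrow> ('a \<Rightarrow> complex) set" where
  "sections T \<H> U =
     {f. continuous_map (subtopology T U) euclidean f \<and> (\<forall>x\<in>U. germ_at T x f \<in> \<H>)}"

definition approx_germs :: "'a topology \<Rightarrow> 'a germ set \<Rightarrow> 'a germ set" where
  "approx_germs T \<H> =
     {germ_at T x f | x f. \<exists>U h. openin T U \<and> x \<in> U \<and>
        continuous_map (subtopology T U) euclidean f \<and>
        (\<forall>k::nat. h k \<in> sections T \<H> U) \<and>
        (\<forall>K. compactin T K \<and> K \<subseteq> U \<longrightarrow> uniform_limit K h f sequentially)}"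

text \<open>\<^const>\<open>approx_germs\<close> is monotone in the set of germs, so the intersection is itself one of
  the sets over which it is taken.\<close>

definition approx_closure :: "'a topology \<Rightarrow> 'a germ set \<Rightarrow> 'a germ set" where
  "approx_closure T \<H> =
     \<Inter>{\<G>. \<G> \<subseteq> continuous_germs T \<and> \<H> \<subseteq> \<G> \<and> approx_germs T \<G> \<subseteq> \<G>}"

definition holomorphic_germs ::
    "'a topology \<Rightarrow> ('a, 'n::finite) chart set \<Rightarrow> 'a set \<Rightarrow> 'a germ set" where
  "holomorphic_germs X \<A> A =
     {germ_at (subtopology X A) x f | x f.
        x \<in> A \<and> (\<exists>V. openin X V \<and> x \<in> V \<and> holomorphic_fun_on \<A> V f)}"

definition LACR ::
    "'a topology \<Rightarrow> ('a, 'n::finite) chart set \<Rightarrow> 'a set \<Rightarrow> 'a germ set" where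
  "LACR X \<A> A = approx_closure (subtopology X A) (holomorphic_germs X \<A> A)"


section \<open>Domains and maxima\<close>

definition rel_compact_domain :: "'a topology \<Rightarrow> 'a set \<Rightarrow> bool" where
  "rel_compact_domain T D \<longleftrightarrow>
     openin T D \<and> connectedin T D \<and> D \<noteq> {} \<and> compactin T (T closure_of D)"

definition is_max_on :: "('a \<Rightarrow> real) \<Rightarrow> 'a set \<Rightarrow> real \<Rightarrow> bool" where
  "is_max_on f S m \<longleftrightarrow> m \<in> f ` S \<and> (\<forall>x\<in>S. f x \<le> m)"

end

theory Submission
  imports Defs "HOL-Complex_Analysis.Cauchy_Integral_Formula"
begin

text \<open>Call \<open>\<psi>\<close> a test function if it is smooth on \<open>\<complex>\<^sup>n\<close> and its complex Hessian is constant with at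
  least \<open>n - q + 1\<close> positive eigenvalues. In the spirit of viscosity solutions, consider the germs
  \<open>f\<close> at points \<open>x\<close> of \<open>A\<close> such that \<open>|f| + \<psi> \<circ> z\<close> has no local maximum on \<open>A\<close> at \<open>x\<close>, for every
  chart \<open>z\<close> and test function \<open>\<psi>\<close>. Holomorphic germs have this property: with \<open>|c| \<le> 1\<close> and
  \<open>c f(x) = |f(x)|\<close>, the function \<open>Re (c f) + \<psi> \<circ> z\<close> would also have a maximum at \<open>x\<close>, although its
  Hessian is that of \<open>\<psi>\<close>, against weak pseudoconcavity. The property is stable under locally
  uniform limits, so all LACR germs have it. If \<open>|u|\<close> attained its maximum over the closure of \<open>D\<close> only
  inside \<open>D\<close>, then so would \<open>|u| + \<epsilon> \<rho>\<close> for small \<open>\<epsilon>\<close>, and replacing \<open>\<epsilon> \<rho>\<close> by its second order Taylor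
  polynomial minus a small multiple of \<open>|z - z(x)|\<^sup>2\<close> gives a forbidden local maximum.\<close>

section \<open>Differentiability classes\<close>

lemma Ck_on_cong:
  assumes "open S" "\<And>x. x \<in> S \<Longrightarrow> f x = g x" "Ck_on k f S"
  shows "Ck_on k g S"
  using assms(2,3)
proof (induction k arbitrary: f g)
  case 0
  then show ?case using continuous_on_cong by force
next
  case (Suc k)
  have hd: "(g has_derivative frechet_derivative f (at x)) (at x)" if "x \<in> S" for x
  proof -
    have "(f has_derivative frechet_derivative f (at x)) (at x)"
      using Suc.prems(2) that by (simp add: frechet_derivative_works[symmetric])
    then show ?thesis
      by (rule has_derivative_transform_within_open[OF _ \<open>open S\<close> that Suc.prems(1)])
  qed
  have eq: "frechet_derivative f (at x) = frechet_derivative g (at x)" if "x \<in> S" for x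
    using frechet_derivative_at[OF hd[OF that]] .
  have "Ck_on k (\<lambda>x. frechet_derivative g (at x) v) S" for v
    using Suc.IH[of "\<lambda>x. frechet_derivative f (at x) v" "\<lambda>x. frechet_derivative g (at x) v"]
      eq Suc.prems by simp
  then show ?case using differentiableI[OF hd] by auto
qed

text \<open>\<open>Ck_on\<close> is phrased with \<open>frechet_derivative\<close>, which is awkward
  to compute. This rule accepts any explicit formula \<open>f'\<close> for the derivative; openness
  of \<open>S\<close> allows the exchange on all of \<open>S\<close>.\<close>

lemma Ck_on_SucI:
  assumes "open S" "\<And>x. x \<in> S \<Longrightarrow> (f has_derivative f' x) (at x)" "\<And>v. Ck_on k (\<lambda>x. f' x v) S"
  shows "Ck_on (Suc k) f S"
proof -
  have eq: "f' x = frechet_derivative f (at x)" if "x \<in> S" for x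
    using frechet_derivative_at[OF assms(2)[OF that]] .
  have "Ck_on k (\<lambda>x. frechet_derivative f (at x) v) S" for v
    by (rule Ck_on_cong[OF assms(1) _ assms(3)]) (simp add: eq)
  then show ?thesis using differentiableI[OF assms(2)] by simp
qed

lemma Ck_on_Suc_imp: "Ck_on (Suc k) f S \<Longrightarrow> Ck_on k f S"
proof (induction k arbitrary: f)
  case 0
  have "isCont f x" if "x \<in> S" for x
    using 0 that by (simp add: differentiable_imp_continuous_within)
  then show ?case by (simp add: continuous_at_imp_continuous_on)
next
  case (Suc k)
  \<comment> \<open>Only the outermost \<open>Suc\<close> of the hypothesis is unfolded: the
    remaining order \<open>Suc k\<close> is what the induction hypothesis takes.\<close>
  have "Ck_on k (\<lambda>x. frechet_derivative f (at x) v) S" for v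
    using Suc.prems by (intro Suc.IH) (subst (asm) Ck_on.simps, blast)
  moreover have "\<forall>x\<in>S. f differentiable (at x)"
    using Suc.prems by (subst (asm) Ck_on.simps, blast)
  ultimately show ?case by simp
qed

lemma Ck_on_subset: "Ck_on k f T \<Longrightarrow> S \<subseteq> T \<Longrightarrow> Ck_on k f S"
proof (induction k arbitrary: f)
  case 0
  then show ?case using continuous_on_subset by auto
qed auto

lemma Ck_on_const: "open S \<Longrightarrow> Ck_on k (\<lambda>x. c) S"
proof (induction k arbitrary: c)
  case (Suc k)
  show ?case by (rule Ck_on_SucI[where f'="\<lambda>x v. 0"]) (use Suc in auto)
qed auto

lemma Ck_on_add:
  assumes "open S" "Ck_on k f S" "Ck_on k g S" shows "Ck_on k (\<lambda>x. f x + g x) S"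
  using assms(2,3)
proof (induction k arbitrary: f g)
  case 0
  then show ?case by (auto intro: continuous_intros)
next
  case (Suc k)
  show ?case
  proof (rule Ck_on_SucI[where f'="\<lambda>x v. frechet_derivative f (at x) v + frechet_derivative g (at x) v",
        OF assms(1)])
    show "((\<lambda>x. f x + g x) has_derivative
        (\<lambda>v. frechet_derivative f (at x) v + frechet_derivative g (at x) v)) (at x)"
      if "x \<in> S" for x
      using Suc.prems that
      by (intro has_derivative_add frechet_derivative_works[THEN iffD1]) simp_all
    show "Ck_on k (\<lambda>x. frechet_derivative f (at x) v + frechet_derivative g (at x) v) S" for v
      using Suc by simp
  qed
qed

lemma Ck_on_bounded_linear:
  assumes "open S" "bounded_linear L" "Ck_on k f S" shows "Ck_on k (\<lambda>x. L (f x)) S"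
  using assms(3)
proof (induction k arbitrary: f)
  case 0
  then show ?case using assms(2) by (auto intro: bounded_linear.continuous_on)
next
  case (Suc k)
  show ?case
  proof (rule Ck_on_SucI[where f'="\<lambda>x v. L (frechet_derivative f (at x) v)", OF assms(1)])
    show "((\<lambda>x. L (f x)) has_derivative (\<lambda>v. L (frechet_derivative f (at x) v))) (at x)"
      if "x \<in> S" for x
      using Suc.prems that
      by (intro bounded_linear.has_derivative[OF assms(2)] frechet_derivative_works[THEN iffD1]) simp
    show "Ck_on k (\<lambda>x. L (frechet_derivative f (at x) v)) S" for v
      using Suc by simp
  qed
qed

text \<open>In the product rule each factor also appears undifferentiated, so the induction needs
  \<open>f\<close> and \<open>g\<close> themselves in class \<open>k\<close>, which
  \<open>Ck_on_Suc_imp\<close> supplies.\<close>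

lemma Ck_on_bounded_bilinear:
  assumes "open S" "bounded_bilinear B" "Ck_on k f S" "Ck_on k g S"
  shows "Ck_on k (\<lambda>x. B (f x) (g x)) S"
  using assms(3,4)
proof (induction k arbitrary: f g)
  case 0
  then show ?case using assms(2) by (auto intro: bounded_bilinear.continuous_on)
next
  case (Suc k)
  have k: "Ck_on k f S" "Ck_on k g S" using Suc.prems Ck_on_Suc_imp by blast+
  show ?case
  proof (rule Ck_on_SucI[where f'="\<lambda>x v. B (f x) (frechet_derivative g (at x) v)
           + B (frechet_derivative f (at x) v) (g x)", OF assms(1)])
    show "((\<lambda>x. B (f x) (g x)) has_derivative (\<lambda>v. B (f x) (frechet_derivative g (at x) v)
           + B (frechet_derivative f (at x) v) (g x))) (at x)" if "x \<in> S" for x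
      using Suc.prems that
      by (intro bounded_bilinear.FDERIV[OF assms(2)] frechet_derivative_works[THEN iffD1]) simp_all
    show "Ck_on k (\<lambda>x. B (f x) (frechet_derivative g (at x) v)
           + B (frechet_derivative f (at x) v) (g x)) S" for v
      using Suc.prems k by (intro Ck_on_add Suc.IH assms(1)) simp_all
  qed
qed

lemma Ck_on_sum:
  assumes "open S" "\<And>i. i \<in> I \<Longrightarrow> Ck_on k (f i) S" shows "Ck_on k (\<lambda>x. \<Sum>i\<in>I. f i x) S"
  using assms(2)
  by (induction I rule: infinite_finite_induct) (auto intro: Ck_on_add Ck_on_const assms(1))

text \<open>The chain rule gives \<open>?f' (g x) (?g' x v)\<close>, whose direction varies with
  \<open>x\<close>, while \<open>Ck_on\<close> controls fixed directions only. Expanding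
  \<open>?g' x v\<close> in the finite basis turns it into a sum of products of class
  \<open>k\<close>.\<close>

lemma Ck_on_compose:
  fixes f :: "'b::euclidean_space \<Rightarrow> 'c::real_normed_vector"
  assumes "open S" "open T" "g ` S \<subseteq> T" "Ck_on k f T" "Ck_on k g S"
  shows "Ck_on k (\<lambda>x. f (g x)) S"
  using assms(4,5)
proof (induction k arbitrary: f)
  case 0
  then show ?case using assms(3) by (auto intro: continuous_on_compose2)
next
  case (Suc k)
  let ?f' = "\<lambda>x. frechet_derivative f (at x)" and ?g' = "\<lambda>x. frechet_derivative g (at x)"
  have lin: "?f' (g x) (?g' x v) = (\<Sum>b\<in>Basis. (?g' x v \<bullet> b) *\<^sub>R ?f' (g x) b)" if "x \<in> S" for x v
  proof -
    have "linear (?f' (g x))"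
      using Suc.prems that assms(3) by (auto intro!: linear_frechet_derivative)
    then have "?f' (g x) (\<Sum>b\<in>Basis. (?g' x v \<bullet> b) *\<^sub>R b) = (\<Sum>b\<in>Basis. (?g' x v \<bullet> b) *\<^sub>R ?f' (g x) b)"
      by (simp add: linear_sum linear_cmul)
    then show ?thesis by (simp add: euclidean_representation)
  qed
  show ?case
  proof (rule Ck_on_SucI[where f'="\<lambda>x v. ?f' (g x) (?g' x v)"])
    show "((\<lambda>x. f (g x)) has_derivative (\<lambda>v. ?f' (g x) (?g' x v))) (at x)" if "x \<in> S" for x
    proof -
      have "(g has_derivative ?g' x) (at x)" "(f has_derivative ?f' (g x)) (at (g x))"
        using that Suc.prems assms(3) by (auto simp: frechet_derivative_works[symmetric])
      then show ?thesis by (rule has_derivative_compose)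
    qed
    fix v
    have "Ck_on k (\<lambda>x. (?g' x v \<bullet> b) *\<^sub>R ?f' (g x) b) S" for b
      using Suc.prems Ck_on_Suc_imp[of k g] assms(1)
      by (intro Ck_on_bounded_bilinear[OF _ bounded_bilinear_scaleR]
          Ck_on_bounded_linear[OF _ bounded_linear_inner_left] Suc.IH) simp_all
    then have "Ck_on k (\<lambda>x. \<Sum>b\<in>Basis. (?g' x v \<bullet> b) *\<^sub>R ?f' (g x) b) S"
      by (intro Ck_on_sum assms(1))
    then show "Ck_on k (\<lambda>x. ?f' (g x) (?g' x v)) S"
      by (rule Ck_on_cong[OF assms(1), rotated]) (simp add: lin)
  qed (rule assms(1))
qed

text \<open>\<open>B\<close> carries no factor 1/2 and need not be symmetric, so the second
  derivative is the symmetrised form \<open>B v w + B w v\<close>.\<close>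

definition quadratic :: "'a::euclidean_space \<Rightarrow> real \<Rightarrow> ('a \<Rightarrow> real) \<Rightarrow> ('a \<Rightarrow> 'a \<Rightarrow> real) \<Rightarrow> 'a \<Rightarrow> real" where
  "quadratic a c L B = (\<lambda>w. c + L (w - a) + B (w - a) (w - a))"

lemma Ck_on_diff_const: "open S \<Longrightarrow> Ck_on k (\<lambda>w. w - a) S"
proof (cases k)
  case (Suc j)
  assume "open S"
  then show ?thesis unfolding Suc
    by (intro Ck_on_SucI[where f'="\<lambda>x v. v"] Ck_on_const)
       (auto intro!: derivative_eq_intros)
qed (auto intro!: continuous_intros)

lemma Ck_on_quadratic:
  assumes "open S" "bounded_linear L" "bounded_bilinear B"
  shows "Ck_on k (quadratic a c L B) S"
  unfolding quadratic_def
  by (intro Ck_on_add Ck_on_const Ck_on_bounded_linear[OF _ assms(2)]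
      Ck_on_bounded_bilinear[OF _ assms(3)] Ck_on_diff_const assms(1))

section \<open>Second derivatives\<close>

text \<open>The inner derivative is taken along \<open>w\<close>, the outer one along
  \<open>v\<close>; that the order is immaterial for C^2 functions is
  \<open>D2_commute\<close>.\<close>

definition D2 :: "('a::real_normed_vector \<Rightarrow> 'b::real_normed_vector) \<Rightarrow> 'a \<Rightarrow> 'a \<Rightarrow> 'a \<Rightarrow> 'b" where
  "D2 f a v w = frechet_derivative (\<lambda>y. frechet_derivative f (at y) w) (at a) v"

lemma Ck_on_2_derivatives:
  assumes "Ck_on 2 f S" "x \<in> S"
  shows "(f has_derivative frechet_derivative f (at x)) (at x)"
    and "((\<lambda>y. frechet_derivative f (at y) w) has_derivative (\<lambda>v. D2 f x v w)) (at x)"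
  using assms
  by (simp_all add: numeral_2_eq_2 D2_def[abs_def] frechet_derivative_works[symmetric])

lemma D2_eqI:
  assumes "open S" "a \<in> S" "\<And>x. x \<in> S \<Longrightarrow> (f has_derivative f' x) (at x)"
    and "((\<lambda>x. f' x w) has_derivative (\<lambda>v. B v)) (at a)"
  shows "D2 f a v w = B v"
proof -
  have eq: "f' x = frechet_derivative f (at x)" if "x \<in> S" for x
    using frechet_derivative_at[OF assms(3)[OF that]] .
  have "((\<lambda>y. frechet_derivative f (at y) w) has_derivative B) (at a)"
    by (rule has_derivative_transform_within_open[OF assms(4,1,2)]) (simp add: eq)
  then show ?thesis unfolding D2_def by (simp add: frechet_derivative_at[symmetric])
qed

lemma D2_add:
  assumes "open S" "a \<in> S" "Ck_on 2 f S" "Ck_on 2 g S"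
  shows "D2 (\<lambda>x. f x + g x) a v w = D2 f a v w + D2 g a v w"
  by (rule D2_eqI[OF assms(1,2)])
     (auto intro!: has_derivative_add Ck_on_2_derivatives assms)

lemma D2_quadratic:
  assumes "bounded_linear L" "bounded_bilinear B"
  shows "D2 (quadratic a c L B) z v w = B v w + B w v"
proof (rule D2_eqI[of UNIV _ _ "\<lambda>x k. L k + (B (x - a) k + B k (x - a))"])
  interpret B: bounded_bilinear B by fact
  show "(quadratic a c L B has_derivative (\<lambda>k. L k + (B (x - a) k + B k (x - a)))) (at x)" for x
  proof -
    have 1: "((\<lambda>w. w - a) has_derivative (\<lambda>k. k)) (at x)"
      by (auto intro!: derivative_eq_intros)
    show ?thesis
      using has_derivative_add[OF has_derivative_add[OF has_derivative_const
          bounded_linear.has_derivative[OF assms(1) 1]] B.FDERIV[OF 1 1], of c]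
      by (simp add: quadratic_def)
  qed
  show "((\<lambda>x. L w + (B (x - a) w + B w (x - a))) has_derivative (\<lambda>v. B v w + B w v)) (at z)"
    by (auto intro!: derivative_eq_intros bounded_linear.has_derivative[OF B.bounded_linear_left]
        bounded_linear.has_derivative[OF B.bounded_linear_right])
qed auto

text \<open>Linearity in \<open>v\<close> is that of a derivative. Linearity in \<open>w\<close>
  holds because the inner derivative is linear in \<open>w\<close> at every point of
  \<open>S\<close> and differentiation preserves this. Finite dimension gives boundedness.\<close>

lemma bounded_bilinear_D2:
  fixes f :: "'a::euclidean_space \<Rightarrow> 'b::euclidean_space"
  assumes "open S" "a \<in> S" "Ck_on 2 f S"
  shows "bounded_bilinear (D2 f a)"
proof -
  have d: "f differentiable at y" if "y \<in> S" for y
    using Ck_on_2_derivatives(1)[OF assms(3) that] differentiableI by blast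
  have l: "linear (frechet_derivative f (at y))" if "y \<in> S" for y
    using d[OF that] by (rule linear_frechet_derivative)
  have 1: "linear (\<lambda>v. D2 f a v w)" for w
    using Ck_on_2_derivatives(2)[OF assms(3,2)] has_derivative_linear by blast
  have 2: "linear (D2 f a v)" for v
  proof
    fix w w' :: 'a and c :: real
    show "D2 f a v (w + w') = D2 f a v w + D2 f a v w'"
      by (rule D2_eqI[OF assms(1,2), of _ "\<lambda>x. frechet_derivative f (at x)"])
         (auto intro!: Ck_on_2_derivatives assms has_derivative_add
           has_derivative_transform_within_open[OF has_derivative_add assms(1,2)]
           simp: linear_add[OF l])
    show "D2 f a v (c *\<^sub>R w) = c *\<^sub>R D2 f a v w"
      by (rule D2_eqI[OF assms(1,2), of _ "\<lambda>x. frechet_derivative f (at x)"])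
         (auto intro!: Ck_on_2_derivatives assms
           has_derivative_transform_within_open[OF has_derivative_scaleR_right assms(1,2)]
           simp: linear_cmul[OF l])
  qed
  have "bilinear (D2 f a)" using 1 2 by (auto simp: bilinear_def)
  then show ?thesis by (rule bilinear_conv_bounded_bilinear[THEN iffD1])
qed

text \<open>\<open>Ck_on\<close> differentiates the first derivative in one fixed direction at a
  time. Uniformity in \<open>k\<close> comes from the finitely many basis directions: tolerance
  \<open>e\<close> divided by the dimension for each, and the least of their radii.\<close>

lemma D2_remainder:
  fixes f :: "'a::euclidean_space \<Rightarrow> real"
  assumes "open S" "a \<in> S" "Ck_on 2 f S" "e > 0"
  obtains d where "d > 0" "ball a d \<subseteq> S"
    "\<And>h k. norm h < d \<Longrightarrow>
      \<bar>frechet_derivative f (at (a + h)) k - frechet_derivative f (at a) k - D2 f a h k\<bar>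
        \<le> e * norm h * norm k"
proof -
  let ?D = "\<lambda>x. frechet_derivative f (at x)"
  let ?R = "\<lambda>h k. ?D (a + h) k - ?D a k - D2 f a h k"
  let ?e = "e / DIM('a)"
  have e: "?e > 0" using assms(4) by simp
  have "\<exists>d>0. \<forall>y. norm (y - a) < d \<longrightarrow>
      norm (?D y b - ?D a b - D2 f a (y - a) b) \<le> ?e * norm (y - a)" for b
    using Ck_on_2_derivatives(2)[OF assms(3,2), of b] e unfolding has_derivative_at_alt by blast
  then obtain d where d: "\<And>b. d b > 0" "\<And>b y. norm (y - a) < d b \<Longrightarrow>
      norm (?D y b - ?D a b - D2 f a (y - a) b) \<le> ?e * norm (y - a)"
    by metis
  obtain r where r: "r > 0" "ball a r \<subseteq> S" using assms(1,2) openE by blast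
  define d' where "d' = Min (insert r (d ` Basis))"
  show thesis
  proof
    show "d' > 0" unfolding d'_def using d(1) r(1) by (subst Min_gr_iff) auto
    have "d' \<le> r" unfolding d'_def by (rule Min_le) auto
    then show S: "ball a d' \<subseteq> S" using r(2) by (auto simp: subset_eq)
    fix h k :: 'a assume h: "norm h < d'"
    have "d' \<le> d b" if "b \<in> Basis" for b unfolding d'_def by (rule Min_le) (use that in auto)
    then have Rb: "\<bar>?R h b\<bar> \<le> ?e * norm h" if "b \<in> Basis" for b
      using d(2)[of "a + h" b] h that by force
    have aS: "a + h \<in> S" using h S by (auto simp: subset_eq dist_norm)
    have lin: "linear (?D y)" if "y \<in> S" for y
      using Ck_on_2_derivatives(1)[OF assms(3) that] has_derivative_linear by blast
    interpret B: bounded_bilinear "D2 f a" using bounded_bilinear_D2[OF assms(1-3)] .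
    define R where "R = ?R h"
    have "linear R" unfolding R_def
      by (intro linear_compose_sub lin aS assms(2) bounded_linear.linear[OF B.bounded_linear_right])
    then have "R (\<Sum>b\<in>Basis. (k \<bullet> b) *\<^sub>R b) = (\<Sum>b\<in>Basis. (k \<bullet> b) *\<^sub>R R b)"
      by (simp add: linear_sum linear_cmul)
    then have "\<bar>?R h k\<bar> = \<bar>\<Sum>b\<in>Basis. (k \<bullet> b) * ?R h b\<bar>"
      by (simp add: euclidean_representation R_def)
    also have "\<dots> \<le> (\<Sum>b\<in>(Basis::'a set). norm k * (?e * norm h))"
    proof (intro order_trans[OF sum_abs] sum_mono)
      show "\<bar>(k \<bullet> b) * ?R h b\<bar> \<le> norm k * (?e * norm h)" if "b \<in> Basis" for b
        unfolding abs_mult by (intro mult_mono Rb Basis_le_norm that) auto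
    qed
    finally show "\<bar>?R h k\<bar> \<le> e * norm h * norm k" by (simp add: field_simps)
  qed
qed

text \<open>The increment starts at \<open>a + v\<close> rather than at \<open>a\<close>, so that
  one estimate yields both the Taylor expansion (\<open>v = 0\<close>) and the symmetry of
  \<open>D2\<close>.\<close>

lemma second_order_estimate:
  fixes f :: "'a::euclidean_space \<Rightarrow> real"
  assumes "open S" "a \<in> S" "Ck_on 2 f S" "e > 0"
  obtains d where "d > 0" "\<And>v w. norm v + norm w < d \<Longrightarrow>
      \<bar>f (a + v + w) - f (a + v) - frechet_derivative f (at a) w - D2 f a v w - D2 f a w w / 2\<bar>
        \<le> e * (norm v + norm w) * norm w"
proof -
  let ?D = "\<lambda>x. frechet_derivative f (at x)"
  obtain d where d: "d > 0" "ball a d \<subseteq> S" "\<And>h k. norm h < d \<Longrightarrow>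
      \<bar>?D (a + h) k - ?D a k - D2 f a h k\<bar> \<le> e * norm h * norm k"
    using D2_remainder[OF assms] by blast
  interpret B: bounded_bilinear "D2 f a" using bounded_bilinear_D2[OF assms(1-3)] .
  show thesis
  proof (rule that[OF d(1)])
    fix v w :: 'a assume vw: "norm v + norm w < d"
    \<comment> \<open>The subtracted terms are chosen so that the derivative of \<phi> at
      \<open>s\<close> is the remainder of \<open>D2_remainder\<close> with
      \<open>h = v + s *\<^sub>R w\<close>; the mean value theorem then bounds
      \<open>\<phi> 1 - \<phi> 0\<close>.\<close>
    define \<phi> where "\<phi> = (\<lambda>s::real. f (a + v + s *\<^sub>R w) - s * ?D a w - s * D2 f a v w - s\<^sup>2 * D2 f a w w / 2)"
    have bd: "norm (v + s *\<^sub>R w) \<le> norm v + norm w" if "0 \<le> s" "s \<le> 1" for s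
    proof -
      have "norm (s *\<^sub>R w) \<le> norm w" using that by (simp add: mult_left_le_one_le)
      then show ?thesis using norm_triangle_ineq[of v "s *\<^sub>R w"] by linarith
    qed
    have "(\<phi> has_real_derivative ?D (a + v + s *\<^sub>R w) w - ?D a w - D2 f a (v + s *\<^sub>R w) w) (at s)"
      if "0 \<le> s" "s \<le> 1" for s
    proof -
      have "a + (v + s *\<^sub>R w) \<in> ball a d" 
        using bd[OF that] vw norm_minus_cancel[of "v + s *\<^sub>R w"]
        by (simp add: dist_norm del: norm_minus_cancel)
      then have "a + v + s *\<^sub>R w \<in> S" using d(2) by (auto simp: add.assoc)
      then have F: "(f has_derivative ?D (a + v + s *\<^sub>R w)) (at (a + v + s *\<^sub>R w))"
        by (rule Ck_on_2_derivatives(1)[OF assms(3)])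
      have "((\<lambda>s. a + v + s *\<^sub>R w) has_derivative (\<lambda>t. t *\<^sub>R w)) (at s)"
        by (auto intro!: derivative_eq_intros)
      from has_derivative_compose[OF this F]
      have "((\<lambda>s. f (a + v + s *\<^sub>R w)) has_derivative (\<lambda>t. t * ?D (a + v + s *\<^sub>R w) w)) (at s)"
        using has_derivative_linear[OF F] by (simp add: linear_cmul)
      then have "((\<lambda>s. f (a + v + s *\<^sub>R w)) has_real_derivative ?D (a + v + s *\<^sub>R w) w) (at s)"
        by (simp add: has_field_derivative_def mult.commute[of _ "?D (a + v + s *\<^sub>R w) w"])
      then show ?thesis unfolding \<phi>_def
        by (auto intro!: derivative_eq_intros simp: B.add_left B.scaleR_left)
    qed
    then obtain s where s: "0 < s" "s < 1" and
      "\<phi> 1 - \<phi> 0 = (1 - 0) * (?D (a + v + s *\<^sub>R w) w - ?D a w - D2 f a (v + s *\<^sub>R w) w)"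
      using MVT2[of 0 1 \<phi> "\<lambda>s. ?D (a + v + s *\<^sub>R w) w - ?D a w - D2 f a (v + s *\<^sub>R w) w"]
      by auto
    then have "\<bar>\<phi> 1 - \<phi> 0\<bar> \<le> e * norm (v + s *\<^sub>R w) * norm w"
      using d(3)[of "v + s *\<^sub>R w" w] bd[of s] vw by (simp add: add.assoc)
    also have "\<dots> \<le> e * (norm v + norm w) * norm w"
      using bd[of s] s assms(4) by (intro mult_right_mono mult_left_mono) auto
    finally show "\<bar>f (a + v + w) - f (a + v) - ?D a w - D2 f a v w - D2 f a w w / 2\<bar>
        \<le> e * (norm v + norm w) * norm w"
      by (simp add: \<phi>_def algebra_simps)
  qed
qed

text \<open>Going from \<open>a\<close> to \<open>a + t *\<^sub>R v + t *\<^sub>R w\<close> in two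
  steps or in one gives two expansions of the same increment. Their second order terms differ by
  half of \<open>D2 f a v w - D2 f a w v\<close>, times the square of \<open>t\<close>.\<close>

lemma D2_commute:
  fixes f :: "'a::euclidean_space \<Rightarrow> real"
  assumes "open S" "a \<in> S" "Ck_on 2 f S"
  shows "D2 f a v w = D2 f a w v"
proof -
  interpret B: bounded_bilinear "D2 f a" using bounded_bilinear_D2[OF assms] .
  let ?D = "frechet_derivative f (at a)"
  have lin: "linear ?D"
    using Ck_on_2_derivatives(1)[OF assms(3,2)] has_derivative_linear by blast
  define N where "N = norm v + norm w + 1"
  have N: "N > 0" unfolding N_def by (simp add: add_nonneg_pos)
  have "\<bar>D2 f a v w - D2 f a w v\<bar> \<le> 6 * e * N\<^sup>2" if e: "e > 0" for e
  proof -
    obtain d where d: "d > 0" "\<And>v w. norm v + norm w < d \<Longrightarrow>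
      \<bar>f (a + v + w) - f (a + v) - ?D w - D2 f a v w - D2 f a w w / 2\<bar>
        \<le> e * (norm v + norm w) * norm w"
      using second_order_estimate[OF assms e] by blast
    define t where "t = d / (2 * N)"
    have t: "t > 0" "t * N < d" using d(1) N by (auto simp: t_def)
    have small: "norm (t *\<^sub>R x) + norm (t *\<^sub>R y) \<le> t * N" if "norm x + norm y \<le> N" for x y :: 'a
      using that t by (simp add: distrib_left[symmetric])
    have est: "\<bar>f (a + t *\<^sub>R x + t *\<^sub>R y) - f (a + t *\<^sub>R x) - t * ?D y - t\<^sup>2 * D2 f a x y - t\<^sup>2 * D2 f a y y / 2\<bar>
        \<le> e * t\<^sup>2 * N\<^sup>2" if "norm x + norm y \<le> N" for x y
    proof -
      have "e * (norm (t *\<^sub>R x) + norm (t *\<^sub>R y)) * norm (t *\<^sub>R y) \<le> e * (t * N) * (t * N)"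
      proof (intro mult_mono mult_left_mono small that)
        show "norm (t *\<^sub>R y) \<le> t * N" using small[OF that] norm_ge_zero[of "t *\<^sub>R x"] by linarith
      qed (use e t N in auto)
      then show ?thesis
        using d(2)[of "t *\<^sub>R x" "t *\<^sub>R y"] small[OF that] t lin
        by (simp add: linear_cmul B.scaleR_left B.scaleR_right power2_eq_square algebra_simps)
    qed
    \<comment> \<open>The three pairs are the step \<open>w\<close> after \<open>v\<close>, the step
      \<open>v\<close> from \<open>a\<close>, and the direct step \<open>v + w\<close> from
      \<open>a\<close>. Each contributes one error term, whence the factor 3 below.\<close>
    have "norm v + norm w \<le> N" "norm (0::'a) + norm v \<le> N" "norm (0::'a) + norm (v + w) \<le> N"
      using norm_triangle_ineq[of v w] norm_ge_zero[of w] by (auto simp: N_def)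
    note E = this[THEN est]
    have "t\<^sup>2 / 2 * \<bar>D2 f a v w - D2 f a w v\<bar> = \<bar>t\<^sup>2 / 2 * (D2 f a v w - D2 f a w v)\<bar>"
      by (simp add: abs_mult)
    also have "\<dots> = \<bar>t\<^sup>2 * D2 f a v w / 2 - t\<^sup>2 * D2 f a w v / 2\<bar>"
      by (simp add: algebra_simps)
    also have "\<dots> \<le> 3 * (e * t\<^sup>2 * N\<^sup>2)"
      using E by (simp add: scaleR_add_right linear_add[OF lin] B.add_left B.add_right B.zero_left
          distrib_left add_divide_distrib add.assoc)
    finally show ?thesis using t by (simp add: field_simps)
  qed
  then have "\<bar>D2 f a v w - D2 f a w v\<bar> \<le> 0 + e" if "e > 0" for e
    using that N by (auto dest!: meta_spec[of _ "e / (6 * N\<^sup>2)"])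
  then have "\<bar>D2 f a v w - D2 f a w v\<bar> \<le> 0" by (rule field_le_epsilon)
  then show ?thesis by simp
qed

section \<open>The complex Hessian as a Levi form\<close>

text \<open>This expands d/dz_i d/dzbar_j, that is (d/dx_i - i d/dy_i)(d/dx_j + i d/dy_j) / 4, with
  \<open>B\<close> in place of the real second derivative.\<close>

definition levi_matrix :: "(complex^'n \<Rightarrow> complex^'n \<Rightarrow> real) \<Rightarrow> complex^'n^'n" where
  "levi_matrix B = (\<chi> i j.
     (of_real (B (axis i 1) (axis j 1) + B (axis i \<i>) (axis j \<i>))
      + \<i> * of_real (B (axis i 1) (axis j \<i>) - B (axis i \<i>) (axis j 1))) / 4)"

lemma complex_hessian_eq_levi_matrix:
  fixes f :: "complex ^ 'n::finite \<Rightarrow> real"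
  assumes "open S" "a \<in> S" "Ck_on 2 f S"
  shows "complex_hessian f a = levi_matrix (D2 f a)"
proof -
  let ?D = "\<lambda>x. frechet_derivative f (at x)"
  have fr: "frechet_derivative (\<lambda>w. complex_of_real (f w)) (at y) = (\<lambda>v. of_real (?D y v))" if "y \<in> S" for y
    using bounded_linear.has_derivative[OF bounded_linear_of_real Ck_on_2_derivatives(1)[OF assms(3) that]]
    by (rule frechet_derivative_at[symmetric])
  have zb: "d_zbar j (\<lambda>w. complex_of_real (f w)) y
      = (of_real (?D y (axis j 1)) + \<i> * of_real (?D y (axis j \<i>))) / 2" if "y \<in> S" for y j
    by (simp add: d_zbar_def fr[OF that])
  have "(d_zbar j (\<lambda>w. complex_of_real (f w)) has_derivative
      (\<lambda>v. (of_real (D2 f a v (axis j 1)) + \<i> * of_real (D2 f a v (axis j \<i>))) / 2)) (at a)" for j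
  proof (rule has_derivative_transform_within_open[OF _ assms(1,2)])
    show "((\<lambda>y. (of_real (?D y (axis j 1)) + \<i> * of_real (?D y (axis j \<i>))) / 2) has_derivative
      (\<lambda>v. (of_real (D2 f a v (axis j 1)) + \<i> * of_real (D2 f a v (axis j \<i>))) / 2)) (at a)"
      using Ck_on_2_derivatives(2)[OF assms(3,2)]
      by (auto intro!: derivative_eq_intros bounded_linear.has_derivative[OF bounded_linear_of_real])
  qed (simp add: zb)
  note fd = frechet_derivative_at[OF this, symmetric]
  show ?thesis
    by (simp add: fd complex_hessian_def levi_matrix_def vec_eq_iff d_z_def field_simps)
qed

text \<open>This is the matrix e H - d I: an eigenvector of \<open>H\<close> for the eigenvalue
  \<open>c\<close> is one of it for \<open>e * c - d\<close>.\<close>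

definition affine_matrix :: "real \<Rightarrow> real \<Rightarrow> complex^'n^'n \<Rightarrow> complex^'n^'n" where
  "affine_matrix e d H = (\<chi> i j. of_real e * H $ i $ j - (if i = j then of_real d else 0))"

text \<open>The real inner product has Levi matrix I/2, since \<open>axis i 1\<close> and
  \<open>axis i \<i>\<close> each contribute 1/4 on the diagonal. Hence the factor 2 in front of
  \<open>d\<close>.\<close>

lemma levi_matrix_affine:
  assumes "\<And>v w. B v w = e * D v w - 2 * d * (v \<bullet> w)"
  shows "levi_matrix B = affine_matrix e d (levi_matrix D)"
  unfolding levi_matrix_def affine_matrix_def
  by (auto simp: assms vec_eq_iff inner_axis_axis field_simps)

lemma complex_hessian_quadratic:
  assumes "bounded_linear L" "bounded_bilinear B"
  shows "complex_hessian (quadratic a c L B) w = levi_matrix (\<lambda>v w. B v w + B w v)"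
  by (subst complex_hessian_eq_levi_matrix[OF open_UNIV _ Ck_on_quadratic[OF open_UNIV assms]])
     (simp_all add: D2_quadratic[OF assms, abs_def])

section \<open>Holomorphic functions of several variables are smooth\<close>

lemma holomorphic_CnD:
  assumes "holomorphic_Cn f S" "z \<in> S"
  shows "(f has_derivative frechet_derivative f (at z)) (at z)"
    "frechet_derivative f (at z) (c *s v) = c * frechet_derivative f (at z) v"
proof -
  obtain f' where f': "(f has_derivative f') (at z)" "\<forall>c v. f' (c *s v) = c * f' v"
    using assms unfolding holomorphic_Cn_def by blast
  then have "f' = frechet_derivative f (at z)" using frechet_derivative_at by blast
  with f' show "(f has_derivative frechet_derivative f (at z)) (at z)"
    "frechet_derivative f (at z) (c *s v) = c * frechet_derivative f (at z) v" by auto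
qed

lemma holomorphic_Cn_subset: "holomorphic_Cn f T \<Longrightarrow> S \<subseteq> T \<Longrightarrow> holomorphic_Cn f S"
  unfolding holomorphic_Cn_def by blast

lemma norm_vector_smult: "norm (c *s v) = norm c * norm (v :: complex ^ 'n::finite)"
  by (simp add: norm_vec_def norm_mult L2_set_right_distrib)

lemma bounded_linear_vector_smult_left: "bounded_linear (\<lambda>c. c *s (v :: complex ^ 'n::finite))"
proof (rule bounded_linear_intro[where K="norm v"])
  show "norm (c *s v) \<le> norm c * norm v" for c by (simp add: norm_vector_smult)
qed (simp_all add: vec_eq_iff algebra_simps)

text \<open>Restriction to complex lines is what reduces the function theory of several variables
  below to that of one variable.\<close>

lemma holomorphic_Cn_line:
  fixes f :: "complex ^ 'n::finite \<Rightarrow> complex"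
  assumes "holomorphic_Cn f S" "z + \<zeta> *s v \<in> S"
  shows "((\<lambda>\<zeta>. f (z + \<zeta> *s v)) has_field_derivative frechet_derivative f (at (z + \<zeta> *s v)) v) (at \<zeta>)"
proof -
  have "((\<lambda>\<zeta>. z + \<zeta> *s v) has_derivative (\<lambda>t. t *s v)) (at \<zeta>)"
    by (auto intro!: derivative_eq_intros
        bounded_linear_imp_has_derivative[OF bounded_linear_vector_smult_left])
  from has_derivative_compose[OF this holomorphic_CnD(1)[OF assms]]
  show ?thesis
    by (simp add: has_field_derivative_def holomorphic_CnD(2)[OF assms] mult_commute_abs)
qed

lemma holomorphic_Cn_Cauchy_estimate:
  fixes f :: "complex ^ 'n::finite \<Rightarrow> complex"
  assumes "holomorphic_Cn f S" "cball z r \<subseteq> S" "r > 0" "\<And>w. w \<in> cball z r \<Longrightarrow> norm (f w) \<le> M"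
  shows "norm (frechet_derivative f (at z) v) \<le> M / r * norm v"
proof (cases "v = 0")
  case True
  have "z \<in> S" using assms(2,3) by auto
  from has_derivative_linear[OF holomorphic_CnD(1)[OF assms(1) this]]
  show ?thesis using True linear_0 by auto
next
  case False
  define g where "g = (\<lambda>\<zeta>. f (z + \<zeta> *s v))"
  \<comment> \<open>The largest parameter radius for which the disc along \<open>v\<close> stays in
    \<open>cball z r\<close>. Cauchy's inequality on it bounds the derivative by
    \<open>M / ?s\<close>.\<close>
  let ?s = "r / norm v"
  have s: "?s > 0" using False assms(3) by simp
  have cb: "z + \<zeta> *s v \<in> cball z r" if "\<zeta> \<in> cball 0 ?s" for \<zeta>
    using that False by (simp add: dist_norm norm_vector_smult field_simps)
  have der: "(g has_field_derivative frechet_derivative f (at (z + \<zeta> *s v)) v) (at \<zeta>)"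
    if "\<zeta> \<in> cball 0 ?s" for \<zeta>
    unfolding g_def using cb[OF that] assms(1,2) by (intro holomorphic_Cn_line) auto
  have "norm ((deriv ^^ 1) g 0) \<le> fact 1 * M / ?s ^ 1"
  proof (rule Cauchy_inequality[OF _ _ s])
    show "g holomorphic_on ball 0 ?s"
      unfolding holomorphic_on_open[OF open_ball]
      using der by (meson ball_subset_cball subsetD)
    show "continuous_on (cball 0 ?s) g"
      using der by (intro continuous_at_imp_continuous_on ballI) (meson DERIV_isCont)
    show "norm (g x) \<le> M" if "norm (0 - x) = ?s" for x
      unfolding g_def using that by (intro assms(4) cb) auto
  qed
  moreover have "deriv g 0 = frechet_derivative f (at z) v"
    using DERIV_imp_deriv[OF der[of 0]] s by simp
  ultimately show ?thesis by simp
qed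

text \<open>First order Taylor expansion along the line. For parameters of modulus at most
  \<open>s\<close>, Cauchy's inequality on discs of radius \<open>s\<close>, which stay within
  radius \<open>2 * s\<close>, bounds the second derivative by
  \<open>2 * M / s\<^sup>2\<close>.\<close>

lemma difference_quotient_estimate:
  fixes f :: "complex ^ 'n::finite \<Rightarrow> complex"
  assumes "holomorphic_Cn f S" "\<And>\<zeta>. norm \<zeta> \<le> 2 * s \<Longrightarrow> z + \<zeta> *s v \<in> S \<and> norm (f (z + \<zeta> *s v)) \<le> M"
    and "s > 0" "norm h \<le> s" "h \<noteq> 0"
  shows "norm ((f (z + h *s v) - f z) / h - frechet_derivative f (at z) v) \<le> 2 * M / s\<^sup>2 * norm h"
proof -
  define g where "g = (\<lambda>\<zeta>. f (z + \<zeta> *s v))"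
  have der: "(g has_field_derivative frechet_derivative f (at (z + \<zeta> *s v)) v) (at \<zeta>)"
    if "norm \<zeta> \<le> 2 * s" for \<zeta>
    unfolding g_def using that assms by (intro holomorphic_Cn_line) auto
  have hol: "g holomorphic_on ball 0 (2 * s)"
    unfolding holomorphic_on_open[OF open_ball] using der by (meson less_imp_le mem_ball_0)
  have "norm (g h - (\<Sum>i\<le>1. (deriv ^^ i) g 0 * (h - 0) ^ i / fact i)) \<le> (2 * M / s\<^sup>2) * norm (h - 0) ^ Suc 1 / fact 1"
  proof (rule complex_Taylor[where f="\<lambda>i. (deriv ^^ i) g" and n=1 and S="cball 0 s", simplified funpow_0])
    show "((deriv ^^ i) g has_field_derivative (deriv ^^ Suc i) g x) (at x within cball 0 s)"
      if "x \<in> cball 0 s" for i x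
    proof -
      have "(deriv ^^ i) g holomorphic_on ball 0 (2 * s)"
        using hol by (intro holomorphic_higher_deriv) auto
      then show ?thesis using that assms(3)
        using holomorphic_derivI[of "(deriv ^^ i) g" "ball 0 (2 * s)" x]
        by (auto intro: has_field_derivative_at_within)
    qed
    show "norm ((deriv ^^ Suc 1) g x) \<le> 2 * M / s\<^sup>2" if x: "x \<in> cball 0 s" for x
    proof -
      have sub: "norm y \<le> 2 * s" if "y \<in> cball x s" for y
        using that x norm_triangle_ineq2[of y x] by (auto simp: dist_norm norm_minus_commute)
      have "norm ((deriv ^^ 2) g x) \<le> fact 2 * M / s ^ 2"
      proof (rule Cauchy_inequality[OF _ _ assms(3)])
        show "g holomorphic_on ball x s"
          unfolding holomorphic_on_open[OF open_ball]
          using der sub by (meson ball_subset_cball subsetD)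
        show "continuous_on (cball x s) g"
          using der sub by (intro continuous_at_imp_continuous_on ballI) (meson DERIV_isCont)
        show "norm (g y) \<le> M" if "norm (x - y) = s" for y
          unfolding g_def using that sub[of y] assms(2)[of y] by (auto simp: dist_norm)
      qed
      then show ?thesis by (simp add: numeral_2_eq_2)
    qed
  qed (use assms in auto)
  moreover have "deriv g 0 = frechet_derivative f (at z) v"
    using DERIV_imp_deriv[OF der[of 0]] assms(3) by simp
  ultimately have "norm (g h - (g 0 + frechet_derivative f (at z) v * h)) \<le> 2 * M / s\<^sup>2 * (norm h)\<^sup>2"
    by (simp add: power2_eq_square)
  moreover have "(f (z + h *s v) - f z) / h - frechet_derivative f (at z) v
      = (g h - (g 0 + frechet_derivative f (at z) v * h)) / h"
    using assms(5) by (simp add: g_def field_simps)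
  ultimately show ?thesis
    using assms(5) by (simp add: norm_divide divide_le_eq power2_eq_square mult.assoc)
qed

text \<open>The Cauchy estimates applied to the differences \<open>f m - f n\<close> make the
  derivatives uniformly Cauchy near \<open>a\<close>. The limit is therefore differentiable, and
  complex linearity of the derivative survives the limit.\<close>

lemma holomorphic_Cn_uniform_limit:
  fixes f :: "nat \<Rightarrow> complex ^ 'n::finite \<Rightarrow> complex"
  assumes "open S" "a \<in> S" "\<And>n. holomorphic_Cn (f n) S" "uniform_limit S f g sequentially"
  shows "\<exists>g'. (g has_derivative g') (at a) \<and> (\<forall>c v. g' (c *s v) = c * g' v)"
proof -
  obtain R where R: "R > 0" "cball a R \<subseteq> S"
    using assms(1,2) open_contains_cball by blast
  \<comment> \<open>Half the radius, so that closed balls of the fixed radius \<open>r\<close>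
    around all points of \<open>ball a r\<close> remain in \<open>S\<close>.\<close>
  define r where "r = R / 2"
  have r: "r > 0" "cball a (2 * r) \<subseteq> S" using R by (simp_all add: r_def)
  let ?D = "\<lambda>n x. frechet_derivative (f n) (at x)"
  have sub: "cball x r \<subseteq> S" if "x \<in> ball a r" for x
  proof
    fix y assume "y \<in> cball x r"
    then have "dist a y \<le> 2 * r" using that dist_triangle[of a y x] by auto
    then show "y \<in> S" using r by auto
  qed
  have fd: "(f n has_derivative ?D n x) (at x)" if "x \<in> ball a r" for n x
    using holomorphic_CnD(1)[OF assms(3)] sub[OF that] r(1) by force
  have cau: "\<exists>N. \<forall>m\<ge>N. \<forall>n\<ge>N. \<forall>x\<in>ball a r. \<forall>v. norm (?D m x v - ?D n x v) \<le> e * norm v"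
    if "e > 0" for e
  proof -
    have er: "e * r > 0" using that r(1) by simp
    have "uniformly_Cauchy_on S f"
      using assms(4) uniformly_convergent_Cauchy uniformly_convergent_on_def by blast
    then obtain N where N: "\<And>m n x. m \<ge> N \<Longrightarrow> n \<ge> N \<Longrightarrow> x \<in> S \<Longrightarrow> dist (f m x) (f n x) < e * r"
      unfolding uniformly_Cauchy_on_def using er by blast
    have "norm (?D m x v - ?D n x v) \<le> e * norm v" if mn: "m \<ge> N" "n \<ge> N" and x: "x \<in> ball a r" for m n x v
    proof -
      let ?h = "\<lambda>x. f m x - f n x"
      have "holomorphic_Cn ?h S"
        unfolding holomorphic_Cn_def
      proof
        fix z assume z: "z \<in> S"
        show "\<exists>f'. (?h has_derivative f') (at z) \<and> (\<forall>c v. f' (c *s v) = c * f' v)"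
          using holomorphic_CnD[OF assms(3) z]
          by (intro exI[of _ "\<lambda>v. ?D m z v - ?D n z v"]) (auto intro: has_derivative_diff simp: algebra_simps)
      qed
      moreover have "norm (?h w) \<le> e * r" if "w \<in> cball x r" for w
        using N[OF mn, of w] sub[OF x] that by (auto simp: dist_norm)
      ultimately have "norm (frechet_derivative ?h (at x) v) \<le> (e * r) / r * norm v"
        using sub[OF x] r(1) by (intro holomorphic_Cn_Cauchy_estimate)
      moreover have "frechet_derivative ?h (at x) = (\<lambda>v. ?D m x v - ?D n x v)"
        by (rule frechet_derivative_at[symmetric]) (intro has_derivative_diff fd x)
      ultimately show ?thesis using r(1) by simp
    qed
    then show ?thesis by blast
  qed
  have "\<exists>l. (\<lambda>n. ?D n x v) \<longlonglongrightarrow> l" if x: "x \<in> ball a r" for x v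
  proof -
    have "Cauchy (\<lambda>n. ?D n x v)"
    proof (rule metric_CauchyI)
      fix e :: real assume e: "e > 0"
      have "e / (norm v + 1) > 0" using e by (simp add: add_nonneg_pos)
      from cau[OF this] obtain N where
        N: "\<And>m n. m \<ge> N \<Longrightarrow> n \<ge> N \<Longrightarrow> norm (?D m x v - ?D n x v) \<le> e / (norm v + 1) * norm v"
        using x by blast
      have "norm v + 1 > 0" by (simp add: add_nonneg_pos)
      then have "e / (norm v + 1) * norm v < e" using e by (simp add: pos_divide_less_eq)
      then have "dist (?D m x v) (?D n x v) < e" if "m \<ge> N" "n \<ge> N" for m n
        using order_le_less_trans[OF N[OF that]] by (simp add: dist_norm)
      then show "\<exists>M. \<forall>m\<ge>M. \<forall>n\<ge>M. dist (?D m x v) (?D n x v) < e" by blast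
    qed
    then show ?thesis by (simp add: Cauchy_convergent_iff convergent_def)
  qed
  then obtain G where G: "\<And>x v. x \<in> ball a r \<Longrightarrow> (\<lambda>n. ?D n x v) \<longlonglongrightarrow> G x v"
    using that[of "\<lambda>x v. lim (\<lambda>n. ?D n x v)"] by (simp add: convergent_def flip: convergent_LIMSEQ_iff)
  have nle: "\<forall>\<^sub>F n in sequentially. \<forall>x\<in>ball a r. \<forall>h. norm (?D n x h - G x h) \<le> e * norm h" if "e > 0" for e
  proof -
    from cau[OF that] obtain N where
      N: "\<And>m n x v. m \<ge> N \<Longrightarrow> n \<ge> N \<Longrightarrow> x \<in> ball a r \<Longrightarrow> norm (?D m x v - ?D n x v) \<le> e * norm v" by blast
    have "norm (?D n x v - G x v) \<le> e * norm v" if "n \<ge> N" "x \<in> ball a r" for n x v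
    proof (rule LIMSEQ_le_const2)
      show "(\<lambda>m. norm (?D n x v - ?D m x v)) \<longlonglongrightarrow> norm (?D n x v - G x v)"
        using G[OF that(2)] by (intro tendsto_intros)
    qed (use N that in blast)
    then show ?thesis unfolding eventually_sequentially by blast
  qed
  have lim: "(\<lambda>n. f n x) \<longlonglongrightarrow> g x" if "x \<in> ball a r" for x
  proof (rule tendsto_uniform_limitI[OF assms(4)])
    show "x \<in> S" using sub[OF that] r(1) by auto
  qed
  have "\<exists>g. \<forall>x\<in>ball a r. (\<lambda>n. f n x) \<longlonglongrightarrow> g x \<and> (g has_derivative G x) (at x within ball a r)"
  proof (rule has_derivative_sequence[OF convex_ball _ nle])
    show "(f n has_derivative ?D n x) (at x within ball a r)" if "x \<in> ball a r" for n x
      by (rule has_derivative_at_withinI[OF fd[OF that]])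
    show "a \<in> ball a r" using r(1) by simp
    then show "(\<lambda>n. f n a) \<longlonglongrightarrow> g a" by (rule lim)
  qed
  then obtain g2 where g2: "\<And>x. x \<in> ball a r \<Longrightarrow> (\<lambda>n. f n x) \<longlonglongrightarrow> g2 x"
    "\<And>x. x \<in> ball a r \<Longrightarrow> (g2 has_derivative G x) (at x within ball a r)"
    by blast
  have a: "a \<in> ball a r" using r by simp
  have "(g2 has_derivative G a) (at a)" using g2(2)[OF a] at_within_open[OF a open_ball] by simp
  \<comment> \<open>\<open>has_derivative_sequence\<close> provides some limit function
    \<open>g2\<close>; it agrees with \<open>g\<close> on the ball by uniqueness of pointwise
    limits.\<close>
  then have "(g has_derivative G a) (at a)"
    by (rule has_derivative_transform_within_open[OF _ open_ball a])
       (rule LIMSEQ_unique[OF g2(1) lim])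
  moreover have "G a (c *s v) = c * G a v" for c v
  proof (rule LIMSEQ_unique)
    show "(\<lambda>n. ?D n a (c *s v)) \<longlonglongrightarrow> G a (c *s v)" by (rule G[OF a])
    have "?D n a (c *s v) = c * ?D n a v" for n using holomorphic_CnD(2)[OF assms(3,2)] .
    then show "(\<lambda>n. ?D n a (c *s v)) \<longlonglongrightarrow> c * G a v" using tendsto_mult_left[OF G[OF a]] by simp
  qed
  ultimately show ?thesis by blast
qed

text \<open>The difference quotients in the direction \<open>v\<close> are holomorphic, and by
  \<open>difference_quotient_estimate\<close> they converge uniformly near each point to the
  directional derivative.\<close>

lemma holomorphic_Cn_directional_derivative:
  fixes f :: "complex ^ 'n::finite \<Rightarrow> complex"
  assumes "open S" "holomorphic_Cn f S"
  shows "holomorphic_Cn (\<lambda>z. frechet_derivative f (at z) v) S"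
  unfolding holomorphic_Cn_def
proof
  fix a assume a: "a \<in> S"
  obtain R where R: "R > 0" "cball a R \<subseteq> S"
    using assms(1) a open_contains_cball by blast
  define N where "N = norm v + 1"
  have N: "N > 0" "norm v \<le> N" by (auto simp: N_def add_nonneg_pos)
  have "continuous_on (cball a R) f"
    using holomorphic_CnD(1)[OF assms(2)] R(2)
    by (intro continuous_at_imp_continuous_on ballI) (meson has_derivative_continuous subsetD)
  then have "bounded (f ` cball a R)"
    by (intro compact_imp_bounded compact_continuous_image) auto
  then obtain M where M: "\<And>z. z \<in> cball a R \<Longrightarrow> norm (f z) \<le> M"
    unfolding bounded_iff by blast
  \<comment> \<open>Moving along \<open>v\<close> by a parameter of modulus at most
    \<open>2 * s\<close> covers at most \<open>2 * s * N = R / 2\<close>, so points of the half ball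
    stay in \<open>cball a R\<close>. The \<open>+ 1\<close> in \<open>N\<close> covers
    \<open>v = 0\<close>.\<close>
  define s where "s = R / (4 * N)"
  have s: "s > 0" using R N by (simp add: s_def)
  have near: "z + \<zeta> *s v \<in> cball a R" if "z \<in> ball a (R / 2)" "norm \<zeta> \<le> 2 * s" for z \<zeta>
  proof -
    have "norm (\<zeta> *s v) \<le> 2 * s * N" unfolding norm_vector_smult
      using that N s by (intro mult_mono) auto
    then have "norm (\<zeta> *s v) \<le> R / 2" using N by (simp add: s_def)
    moreover have "norm (z - a) < R / 2" using that(1) by (simp add: dist_norm norm_minus_commute)
    ultimately have "norm ((z - a) + \<zeta> *s v) \<le> R"
      using norm_triangle_ineq[of "z - a" "\<zeta> *s v"] by linarith
    then show ?thesis by (simp add: dist_norm norm_minus_commute[of a] algebra_simps)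
  qed
  define h where "h = (\<lambda>n::nat. complex_of_real (s * inverse (real (Suc n))))"
  have h: "norm (h n) \<le> s" "h n \<noteq> 0" for n
    using s unfolding h_def norm_of_real of_real_eq_0_iff by (auto simp: divide_simps)
  have h0: "h \<longlonglongrightarrow> 0"
    unfolding h_def
    using tendsto_of_real[OF tendsto_mult_left[OF LIMSEQ_inverse_real_of_nat, of s], where 'a=complex]
    by (simp only: mult_zero_right of_real_0)
  define Q where "Q = (\<lambda>n z. (f (z + h n *s v) - f z) / h n)"
  show "\<exists>g'. ((\<lambda>z. frechet_derivative f (at z) v) has_derivative g') (at a) \<and> (\<forall>c w. g' (c *s w) = c * g' w)"
  proof (rule holomorphic_Cn_uniform_limit[of "ball a (R / 2)" a Q])
    show "holomorphic_Cn (Q n) (ball a (R / 2))" for n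
      unfolding holomorphic_Cn_def
    proof
      fix z assume z: "z \<in> ball a (R / 2)"
      have zS: "z \<in> S" "z + h n *s v \<in> S"
        using near[OF z, of 0] near[OF z, of "h n"] h[of n] s R(2) by auto
      note D1 = holomorphic_CnD[OF assms(2) zS(1)] and D2 = holomorphic_CnD[OF assms(2) zS(2)]
      have "((\<lambda>z. z + h n *s v) has_derivative (\<lambda>w. w)) (at z)"
        by (auto intro!: derivative_eq_intros)
      from has_derivative_compose[OF this D2(1)]
      have "((\<lambda>z. f (z + h n *s v)) has_derivative frechet_derivative f (at (z + h n *s v))) (at z)" .
      from bounded_linear.has_derivative[OF bounded_linear_divide has_derivative_diff[OF this D1(1)]]
      have "(Q n has_derivative (\<lambda>w. (frechet_derivative f (at (z + h n *s v)) w
          - frechet_derivative f (at z) w) / h n)) (at z)"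
        unfolding Q_def .
      then show "\<exists>f'. (Q n has_derivative f') (at z) \<and> (\<forall>c w. f' (c *s w) = c * f' w)"
        by (intro exI conjI) (auto simp: D1(2) D2(2) algebra_simps diff_divide_distrib)
    qed
    have ev: "\<forall>\<^sub>F n in sequentially. norm (2 * M / s\<^sup>2 * norm (h n)) < e" if "e > 0" for e
      using tendstoD[OF tendsto_mult_left[OF tendsto_norm[OF h0], of "2 * M / s\<^sup>2"] that] by simp
    have bd: "norm (Q n z - frechet_derivative f (at z) v) \<le> 2 * M / s\<^sup>2 * norm (h n)"
      if "z \<in> ball a (R / 2)" for n z
      unfolding Q_def
      by (rule difference_quotient_estimate[OF assms(2) _ s h]) (use near[OF that] M R(2) in auto)
    show "uniform_limit (ball a (R / 2)) Q (\<lambda>z. frechet_derivative f (at z) v) sequentially"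
      unfolding uniform_limit_iff
    proof (intro allI impI)
      fix e :: real assume "e > 0"
      from ev[OF this]
      show "\<forall>\<^sub>F n in sequentially. \<forall>z\<in>ball a (R / 2). dist (Q n z) (frechet_derivative f (at z) v) < e"
      proof eventually_elim
        case (elim n)
        show ?case unfolding dist_norm
          using order_le_less_trans[OF bd] order_le_less_trans[OF abs_ge_self elim[unfolded real_norm_def]]
          by blast
      qed
    qed
  next
    show "open (ball a (R / 2))" "a \<in> ball a (R / 2)" using R(1) by simp_all
  qed
qed

lemma holomorphic_Cn_Ck_on:
  fixes f :: "complex ^ 'n::finite \<Rightarrow> complex"
  assumes "open S" "holomorphic_Cn f S"
  shows "Ck_on k f S"
  using assms(2)
proof (induction k arbitrary: f)
  case 0
  have "isCont f x" if "x \<in> S" for x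
    using has_derivative_continuous[OF holomorphic_CnD(1)[OF _ that]] 0 by simp
  then show ?case by (simp add: continuous_at_imp_continuous_on)
next
  case (Suc k)
  show ?case
    by (rule Ck_on_SucI[OF assms(1) holomorphic_CnD(1)[OF Suc.prems]
        Suc.IH[OF holomorphic_Cn_directional_derivative[OF assms(1) Suc.prems]]])
qed

section \<open>Counting positive eigenvalues\<close>

text \<open>Eigenspaces are unchanged while the eigenvalue \<open>c\<close> moves to
  \<open>e * c - d\<close>. As long as \<open>d\<close> is below \<open>e\<close> times the least
  positive eigenvalue, none of the positive ones is lost.\<close>

lemma num_pos_eigenvalues_affine_matrix:
  fixes H :: "complex ^ 'n::finite ^ 'n"
  assumes "e > 0"
  obtains d0 where "d0 > 0"
    "\<And>d. 0 \<le> d \<Longrightarrow> d < d0 \<Longrightarrow> num_pos_eigenvalues (affine_matrix e d H) \<ge> num_pos_eigenvalues H"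
proof (cases "num_pos_eigenvalues H = 0")
  case True
  then show thesis using that[of 1] by simp
next
  case False
  define P where "P = {c::real. c > 0 \<and> (\<exists>v\<in>eigenspace H (of_real c). v \<noteq> 0)}"
  have "(\<Sum>c\<in>P. vec.dim (eigenspace H (of_real c))) \<noteq> 0"
    using False by (simp add: num_pos_eigenvalues_def P_def)
  \<comment> \<open>A sum over an infinite set is 0 by convention, as is the empty sum, so a nonzero
    count gives both facts without spectral theory.\<close>
  then have fin: "finite P" and ne: "P \<noteq> {}" by (auto intro: ccontr)
  have mult: "affine_matrix e d H *v v = of_real e *s (H *v v) - of_real d *s v" for d v
    by (simp add: vec_eq_iff affine_matrix_def matrix_vector_mult_def sum_subtractf sum_distrib_left
        left_diff_distrib mult.assoc if_distrib[of "\<lambda>x. x * _"] cong: if_cong)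
  have espace: "eigenspace (affine_matrix e d H) (of_real (e * c - d)) = eigenspace H (of_real c)" for c d
  proof -
    have "of_real e *s w - of_real d *s v = of_real (e * c - d) *s v \<longleftrightarrow> w = of_real c *s v"
      for v w :: "complex ^ 'n"
      using assms by (auto simp: vec_eq_iff algebra_simps)
    then show ?thesis by (simp add: eigenspace_def mult)
  qed
  show thesis
  proof (rule that)
    show "e * Min P > 0" using fin ne assms by (simp add: P_def)
    fix d assume d: "0 \<le> d" "d < e * Min P"
    let ?P' = "{c::real. c > 0 \<and> (\<exists>v\<in>eigenspace (affine_matrix e d H) (of_real c). v \<noteq> 0)}"
    have eq: "?P' = (\<lambda>c. e * c - d) ` P"
    proof (intro equalityI subsetI)
      fix c assume c: "c \<in> ?P'"
      have c': "c = e * ((c + d) / e) - d" using assms by simp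
      have "eigenspace (affine_matrix e d H) (of_real c) = eigenspace H (of_real ((c + d) / e))"
        using espace[of d "(c + d) / e"] by (simp only: c'[symmetric])
      then have "(c + d) / e \<in> P"
        using c d(1) assms unfolding P_def by simp
      then show "c \<in> (\<lambda>c. e * c - d) ` P" using c' by (rule rev_image_eqI)
    next
      fix c assume "c \<in> (\<lambda>c. e * c - d) ` P"
      then obtain c' where c': "c' \<in> P" "c = e * c' - d" by auto
      have "e * Min P \<le> e * c'" using c'(1) fin assms by simp
      then show "c \<in> ?P'"
        using c' d(2) unfolding c'(2) mem_Collect_eq espace by (auto simp: P_def)
    qed
    have inj: "inj_on (\<lambda>c. e * c - d) P" using assms by (auto simp: inj_on_def)
    show "num_pos_eigenvalues H \<le> num_pos_eigenvalues (affine_matrix e d H)"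
      unfolding num_pos_eigenvalues_def[of "affine_matrix e d H"] eq sum.reindex[OF inj] comp_def espace
      by (simp add: num_pos_eigenvalues_def P_def)
  qed
qed

section \<open>Test functions\<close>

text \<open>The constant Hessian \<open>H\<close> is exposed as a parameter so that the eigenvalue
  bound can be imposed on it once for all points; the definition itself contains no such
  bound.\<close>

definition test_function :: "(complex ^ 'n::finite \<Rightarrow> real) \<Rightarrow> complex ^ 'n ^ 'n \<Rightarrow> bool" where
  "test_function \<psi> H \<longleftrightarrow> (\<forall>k. Ck_on k \<psi> UNIV) \<and> (\<forall>w. complex_hessian \<psi> w = H)"

lemma test_function_quadratic:
  fixes D :: "complex ^ 'n::finite \<Rightarrow> complex ^ 'n \<Rightarrow> real"
  assumes "bounded_linear L" "bounded_bilinear B"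
    and "\<And>v w. B v w + B w v = e * D v w - 2 * d * (v \<bullet> w)"
  shows "test_function (quadratic a c L B) (affine_matrix e d (levi_matrix D))"
  unfolding test_function_def
  using Ck_on_quadratic[OF open_UNIV assms(1,2)] levi_matrix_affine[OF assms(3)]
  by (simp add: complex_hessian_quadratic[OF assms(1,2)])

lemma bounded_bilinear_add:
  fixes B C :: "'a::euclidean_space \<Rightarrow> 'a \<Rightarrow> real"
  assumes "bounded_bilinear B" "bounded_bilinear C"
  shows "bounded_bilinear (\<lambda>v w. B v w + C v w)"
  using assms unfolding bilinear_conv_bounded_bilinear[symmetric] bilinear_def
  by (auto intro!: linear_compose_add)

lemma bounded_bilinear_mult_left:
  fixes B :: "'a::euclidean_space \<Rightarrow> 'a \<Rightarrow> real"
  assumes "bounded_bilinear B"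
  shows "bounded_bilinear (\<lambda>v w. c * B v w)"
  using assms unfolding bilinear_conv_bounded_bilinear[symmetric] bilinear_def
  by (simp add: linear_iff distrib_left)

text \<open>The subtracted term is a \<open>quadratic\<close> with second derivative
  \<open>2 * d\<close> times the inner product, whose Levi matrix is d times the identity.\<close>

lemma test_function_perturb:
  assumes "test_function \<psi> H"
  shows "test_function (\<lambda>w. \<psi> w - d * (norm (w - a))\<^sup>2) (affine_matrix 1 d H)"
proof -
  let ?B = "\<lambda>v w. (- d) * (v \<bullet> w)" and ?L = "\<lambda>_. 0 :: real"
  let ?Q = "quadratic a 0 ?L ?B"
  note bl = bounded_linear_zero bounded_bilinear_mult_left[OF bounded_bilinear_inner, of "- d"]
  have eq: "(\<lambda>w. \<psi> w - d * (norm (w - a))\<^sup>2) = (\<lambda>w. \<psi> w + ?Q w)"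
    by (auto simp: quadratic_def power2_norm_eq_inner)
  have Ck: "Ck_on k \<psi> UNIV" "Ck_on k ?Q UNIV" for k
    using assms Ck_on_quadratic[OF open_UNIV bl] by (auto simp: test_function_def)
  have sum: "Ck_on k (\<lambda>w. \<psi> w + ?Q w) UNIV" for k using Ck_on_add[OF open_UNIV Ck] .
  have "complex_hessian (\<lambda>w. \<psi> w + ?Q w) w = affine_matrix 1 d (complex_hessian \<psi> w)" for w
    unfolding complex_hessian_eq_levi_matrix[OF open_UNIV UNIV_I sum]
      complex_hessian_eq_levi_matrix[OF open_UNIV UNIV_I Ck(1)]
    by (rule levi_matrix_affine)
       (simp only: D2_add[OF open_UNIV UNIV_I Ck] D2_quadratic[OF bl], simp add: inner_commute)
  then show ?thesis using sum assms by (simp add: test_function_def eq)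
qed

text \<open>Replaces a merely C^2 function by a smooth one touching it from below: the second order
  Taylor polynomial of \<open>e * f\<close> minus \<open>d\<close> times the squared distance. This
  \<open>d\<close> absorbs the Taylor remainder, yet is too small to lose a positive
  eigenvalue.\<close>

lemma test_function_below:
  fixes f :: "complex ^ 'n::finite \<Rightarrow> real"
  assumes "open S" "a \<in> S" "Ck_on 2 f S" "e > 0"
  obtains \<psi> H r where "test_function \<psi> H" "num_pos_eigenvalues H \<ge> num_pos_eigenvalues (complex_hessian f a)"
    "r > 0" "\<psi> a = e * f a" "\<And>w. w \<in> ball a r \<Longrightarrow> \<psi> w \<le> e * f w"
proof -
  let ?D = "frechet_derivative f (at a)"
  obtain d0 where d0: "d0 > 0" "\<And>d. 0 \<le> d \<Longrightarrow> d < d0 \<Longrightarrow>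
      num_pos_eigenvalues (affine_matrix e d (complex_hessian f a)) \<ge> num_pos_eigenvalues (complex_hessian f a)"
    using num_pos_eigenvalues_affine_matrix[OF assms(4)] by blast
  define d where "d = d0 / 2"
  have d: "0 < d" "0 \<le> d" "d < d0" using d0 by (auto simp: d_def)
  interpret B: bounded_bilinear "D2 f a" using bounded_bilinear_D2[OF assms(1-3)] .
  \<comment> \<open>Half of the intended second derivative, since \<open>quadratic\<close>
    symmetrises and thereby doubles it.\<close>
  define B where "B = (\<lambda>v w. e / 2 * D2 f a v w + (- d) * (v \<bullet> w))"
  have L: "bounded_linear (\<lambda>k. e * ?D k)"
    using has_derivative_bounded_linear[OF Ck_on_2_derivatives(1)[OF assms(3,2)]]
    by (rule bounded_linear_const_mult)
  have B: "bounded_bilinear B" unfolding B_def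
    by (intro bounded_bilinear_add bounded_bilinear_mult_left bounded_bilinear_inner
        bounded_bilinear_D2[OF assms(1-3)])
  \<comment> \<open>The tolerance is \<open>d / e\<close> because the estimate is later multiplied
    by \<open>e\<close>; it is used only with \<open>v = 0\<close>.\<close>
  obtain r where r: "r > 0" "\<And>v w. norm v + norm w < r \<Longrightarrow>
      \<bar>f (a + v + w) - f (a + v) - ?D w - D2 f a v w - D2 f a w w / 2\<bar> \<le> d / e * (norm v + norm w) * norm w"
    using second_order_estimate[OF assms(1-3), of "d / e"] d(1) assms(4) by auto
  show thesis
  proof (rule that[of "quadratic a (e * f a) (\<lambda>k. e * ?D k) B" "affine_matrix e d (levi_matrix (D2 f a))"])
    show "test_function (quadratic a (e * f a) (\<lambda>k. e * ?D k) B) (affine_matrix e d (levi_matrix (D2 f a)))"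
    proof (rule test_function_quadratic[OF L B])
      show "B v w + B w v = e * D2 f a v w - 2 * d * (v \<bullet> w)" for v w
        unfolding B_def D2_commute[OF assms(1-3), of w v] inner_commute[of w v] by simp
    qed
    show "num_pos_eigenvalues (complex_hessian f a) \<le> num_pos_eigenvalues (affine_matrix e d (levi_matrix (D2 f a)))"
      using d0(2)[OF d(2,3)] unfolding complex_hessian_eq_levi_matrix[OF assms(1-3)] .
    show "quadratic a (e * f a) (\<lambda>k. e * ?D k) B a = e * f a"
      using linear_0[OF bounded_linear.linear[OF L]] bounded_bilinear.zero_left[OF B]
      by (simp add: quadratic_def)
    fix w assume "w \<in> ball a r"
    then have "norm (0::complex^'n) + norm (w - a) < r" by (simp add: dist_norm norm_minus_commute)
    from r(2)[OF this] have "f a + ?D (w - a) + D2 f a (w - a) (w - a) / 2 - f w \<le> d / e * (norm (w - a))\<^sup>2"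
      by (simp add: B.zero_left power2_eq_square)
    then have "e * (f a + ?D (w - a) + D2 f a (w - a) (w - a) / 2 - f w) \<le> e * (d / e * (norm (w - a))\<^sup>2)"
      using assms(4) by (intro mult_left_mono) auto
    then show "quadratic a (e * f a) (\<lambda>k. e * ?D k) B w \<le> e * f w"
      using assms(4) by (simp add: quadratic_def B_def power2_norm_eq_inner algebra_simps)
  qed (rule r(1))
qed

section \<open>Adding the real part of a holomorphic function\<close>

lemma D2_cong:
  assumes "open S" "a \<in> S" "Ck_on 2 f S" "\<And>x. x \<in> S \<Longrightarrow> f x = g x"
  shows "D2 g a v w = D2 f a v w"
proof (rule D2_eqI[OF assms(1,2)])
  show "(g has_derivative frechet_derivative f (at x)) (at x)" if "x \<in> S" for x
    by (rule has_derivative_transform_within_open[OF Ck_on_2_derivatives(1)[OF assms(3) that] assms(1) that assms(4)])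
qed (rule Ck_on_2_derivatives(2)[OF assms(3,2)])

text \<open>The first slot is complex linear because the directional derivative is again
  holomorphic, the second because the derivative of \<open>F\<close> is complex linear at every
  point near \<open>a\<close>.\<close>

lemma D2_holomorphic_smult:
  fixes F :: "complex ^ 'n::finite \<Rightarrow> complex"
  assumes "open S" "a \<in> S" "holomorphic_Cn F S"
  shows "D2 F a (c *s v) w = c * D2 F a v w" "D2 F a v (c *s w) = c * D2 F a v w"
proof -
  note hol' = holomorphic_Cn_directional_derivative[OF assms(1,3)]
  show "D2 F a (c *s v) w = c * D2 F a v w"
    unfolding D2_def by (rule holomorphic_CnD(2)[OF hol' assms(2)])
  show "D2 F a v (c *s w) = c * D2 F a v w"
  proof (rule D2_eqI[OF assms(1,2) holomorphic_CnD(1)[OF assms(3)]])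
    have "((\<lambda>x. c * frechet_derivative F (at x) w) has_derivative (\<lambda>v. c * D2 F a v w)) (at a)"
      using holomorphic_CnD(1)[OF hol' assms(2)] unfolding D2_def
      by (rule has_derivative_mult_right)
    then show "((\<lambda>x. frechet_derivative F (at x) (c *s w)) has_derivative (\<lambda>v. c * D2 F a v w)) (at a)"
      by (rule has_derivative_transform_within_open[OF _ assms(1,2)])
         (simp add: holomorphic_CnD(2)[OF assms(3)])
  qed
qed

text \<open>The real part of a holomorphic function is pluriharmonic. By complex bilinearity of
  \<open>D2 F a\<close>, replacing both directions by their multiples by \<i> changes the sign, and
  moving \<i> from one slot to the other changes nothing, so all entries of the Levi matrix
  cancel.\<close>

lemma complex_hessian_add_Re_holomorphic:
  fixes F :: "complex ^ 'n::finite \<Rightarrow> complex"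
  assumes "open S" "a \<in> S" "holomorphic_Cn F S" "Ck_on 2 \<psi> S"
    "\<And>w. w \<in> S \<Longrightarrow> g w = Re (c * F w) + \<psi> w"
  shows "complex_hessian g a = complex_hessian \<psi> a"
proof -
  let ?R = "\<lambda>w. Re (c * F w)"
  have lin: "bounded_linear (\<lambda>v. Re (c * v))"
    by (intro bounded_linear_compose[OF bounded_linear_Re bounded_linear_mult_right])
  have FC: "Ck_on 2 F S" by (rule holomorphic_Cn_Ck_on[OF assms(1,3)])
  have C: "Ck_on 2 ?R S" by (rule Ck_on_bounded_linear[OF assms(1) lin FC])
  have S: "Ck_on 2 (\<lambda>w. ?R w + \<psi> w) S" by (rule Ck_on_add[OF assms(1) C assms(4)])
  have g: "Ck_on 2 g S" by (rule Ck_on_cong[OF assms(1) _ S]) (simp add: assms(5))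
  have DR: "D2 ?R a v w = Re (c * D2 F a v w)" for v w
  proof (rule D2_eqI[where f'="\<lambda>x k. Re (c * frechet_derivative F (at x) k)", OF assms(1,2)])
    show "(?R has_derivative (\<lambda>k. Re (c * frechet_derivative F (at x) k))) (at x)" if "x \<in> S" for x
      using bounded_linear.has_derivative[OF lin Ck_on_2_derivatives(1)[OF FC that]] .
    show "((\<lambda>x. Re (c * frechet_derivative F (at x) w)) has_derivative (\<lambda>v. Re (c * D2 F a v w))) (at a)"
      using bounded_linear.has_derivative[OF lin Ck_on_2_derivatives(2)[OF FC assms(2), of w]] .
  qed
  have Dg: "D2 g a v w = Re (c * D2 F a v w) + D2 \<psi> a v w" for v w
  proof -
    have "D2 g a v w = D2 (\<lambda>w. ?R w + \<psi> w) a v w"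
      by (rule D2_cong[OF assms(1,2) S]) (simp add: assms(5))
    then show ?thesis unfolding D2_add[OF assms(1,2) C assms(4)] DR .
  qed
  have ax: "axis i \<i> = \<i> *s axis i 1" for i :: 'n by (simp add: axis_def vec_eq_iff)
  show ?thesis
    unfolding complex_hessian_eq_levi_matrix[OF assms(1,2) g]
      complex_hessian_eq_levi_matrix[OF assms(1,2,4)]
    unfolding levi_matrix_def vec_eq_iff Dg ax D2_holomorphic_smult[OF assms(1-3)]
    by (simp add: algebra_simps)
qed

section \<open>Charts\<close>

lemma Ck_on_imp_continuous_on: "Ck_on k f S \<Longrightarrow> continuous_on S f"
proof (induction k)
  case (Suc k)
  then show ?case using Ck_on_Suc_imp by blast
qed simp

lemma Ck_on_vec:
  fixes G :: "'a::real_normed_vector \<Rightarrow> complex ^ 'n::finite"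
  assumes "open S" "\<And>i. Ck_on k (\<lambda>x. G x $ i) S"
  shows "Ck_on k G S"
proof -
  have "Ck_on k (\<lambda>x. \<Sum>i\<in>UNIV. (G x $ i) *s axis i 1) S"
    by (intro Ck_on_sum assms Ck_on_bounded_linear[OF _ bounded_linear_vector_smult_left])
  then show ?thesis by (simp only: basis_expansion)
qed

locale complex_manifold_charts =
  fixes X :: "'a topology" and \<A> :: "('a, 'n::finite) chart set"
  assumes manifold: "complex_manifold X \<A>"
begin

lemma chart:
  assumes "(U, z) \<in> \<A>"
  shows "openin X U" "open (z ` U)" "homeomorphic_map (subtopology X U) (top_of_set (z ` U)) z"
    "inj_on z U" "topspace (subtopology X U) = U"
proof -
  show *: "openin X U" "open (z ` U)" "homeomorphic_map (subtopology X U) (top_of_set (z ` U)) z"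
    using manifold assms unfolding complex_manifold_def by auto
  show "topspace (subtopology X U) = U" using openin_subset[OF *(1)] by auto
  then show "inj_on z U" using homeomorphic_imp_injective_map[OF *(3)] by simp
qed

lemma chart_exists:
  assumes "x \<in> topspace X" obtains U z where "(U, z) \<in> \<A>" "x \<in> U"
proof -
  have "topspace X = (\<Union>(U, z)\<in>\<A>. U)" using manifold unfolding complex_manifold_def by blast
  then show ?thesis using assms that by auto
qed

lemma chart_open_image:
  assumes "(U, z) \<in> \<A>" "openin X V" shows "open (z ` (U \<inter> V))"
proof -
  have "openin (subtopology X U) (U \<inter> V)"
    using assms(2) by (simp add: openin_subtopology_Int2)
  then have "openin (top_of_set (z ` U)) (z ` (U \<inter> V))"
    using homeomorphic_imp_open_map[OF chart(3)[OF assms(1)]] by (simp add: open_map_def)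
  then show ?thesis using chart(2)[OF assms(1)] openin_open_trans by blast
qed

lemma chart_open_vimage:
  assumes "(U, z) \<in> \<A>" "open W" shows "openin X {y\<in>U. z y \<in> W}"
proof -
  have "openin (subtopology X U) {y\<in>topspace (subtopology X U). z y \<in> z ` U \<inter> W}"
    by (rule openin_continuous_map_preimage[OF homeomorphic_imp_continuous_map[OF chart(3)[OF assms(1)]]])
       (simp add: assms(2) openin_open_Int)
  moreover have "{y\<in>topspace (subtopology X U). z y \<in> z ` U \<inter> W} = {y\<in>U. z y \<in> W}"
    unfolding chart(5)[OF assms(1)] by auto
  ultimately show ?thesis using openin_trans_full chart(1)[OF assms(1)] by metis
qed

lemma chart_compact_vimage:
  assumes "(U, z) \<in> \<A>" "compact K" "K \<subseteq> z ` U" shows "compactin X {y\<in>U. z y \<in> K}"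
proof -
  have "z ` {y\<in>U. z y \<in> K} = K" using assms(3) by auto
  moreover have "compactin (top_of_set (z ` U)) K"
    using assms(2,3) by (simp add: compactin_subtopology)
  ultimately have "compactin (subtopology X U) {y\<in>U. z y \<in> K}"
    using homeomorphic_map_compactness_eq[OF chart(3)[OF assms(1)]] chart(5)[OF assms(1)] by auto
  then show ?thesis by (simp add: compactin_subtopology)
qed

lemma chart_continuous:
  assumes "(U, z) \<in> \<A>" "W \<subseteq> U" "continuous_on (z ` W) (f \<circ> inv_into U z)"
  shows "continuous_map (subtopology X W) euclidean f"
proof -
  have "continuous_map (subtopology (subtopology X U) W) (subtopology (top_of_set (z ` U)) (z ` W)) z"
    using continuous_map_from_subtopology[OF homeomorphic_imp_continuous_map[OF chart(3)[OF assms(1)]]]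
    by (auto simp: continuous_map_in_subtopology)
  then have "continuous_map (subtopology X W) (top_of_set (z ` W)) z"
    using assms(2) by (simp add: subtopology_subtopology inf.absorb2 image_mono)
  moreover have "continuous_map (top_of_set (z ` W)) euclidean (f \<circ> inv_into U z)"
    using assms(3) by simp
  ultimately have "continuous_map (subtopology X W) euclidean ((f \<circ> inv_into U z) \<circ> z)"
    by (rule continuous_map_compose)
  then show ?thesis
    by (rule continuous_map_eq) (use assms(2) chart(4)[OF assms(1)] in auto)
qed

lemma chart_continuous_map:
  assumes "(U, z) \<in> \<A>" shows "continuous_map (subtopology X U) euclidean z"
  using homeomorphic_imp_continuous_map[OF chart(3)[OF assms]] by (simp add: continuous_map_in_subtopology)

text \<open>Chart domains are open and cover \<open>X\<close>, so continuity in coordinates pastes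
  together to continuity on \<open>X\<close>.\<close>

lemma Ck_fun_on_continuous:
  assumes "Ck_fun_on \<A> k (topspace X) \<rho>"
  shows "continuous_map X euclidean \<rho>"
proof (rule pasting_lemma[where I=\<A> and T=fst and f="\<lambda>_. \<rho>"])
  fix c assume "c \<in> \<A>"
  then obtain U z where c: "c = (U, z)" "(U, z) \<in> \<A>" by (cases c) auto
  then show "openin X (fst c)" using chart(1) by simp
  have "U \<inter> topspace X = U" using openin_subset[OF chart(1)[OF c(2)]] by blast
  then have "Ck_on k (\<rho> \<circ> inv_into U z) (z ` U)"
    using assms c(2) unfolding Ck_fun_on_def by fastforce
  then have "continuous_on (z ` U) (\<rho> \<circ> inv_into U z)"
    by (rule Ck_on_imp_continuous_on)
  then show "continuous_map (subtopology X (fst c)) euclidean \<rho>"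
    using chart_continuous[OF c(2) order_refl] c(1) by simp
next
  show "\<exists>c. c \<in> \<A> \<and> x \<in> fst c \<and> \<rho> x = \<rho> x" if "x \<in> topspace X" for x
    using chart_exists[OF that] by (metis fst_conv)
qed auto

text \<open>Smoothness has to be checked in every chart \<open>z'\<close>, not only in
  \<open>z\<close>. There \<open>f\<close> and the transition map to \<open>z\<close> are
  holomorphic, hence of every class \<open>k\<close>, and the chain rule treats \<psi>.\<close>

lemma smooth_fun_on_Re_holomorphic_add:
  assumes "(U, z) \<in> \<A>" "openin X V" "V' \<subseteq> V \<inter> U" "openin X V'"
    "holomorphic_fun_on \<A> V f" "\<And>k. Ck_on k \<psi> UNIV"
  shows "smooth_fun_on \<A> V' (\<lambda>y. Re (c * f y) + \<psi> (z y))"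
  unfolding smooth_fun_on_def Ck_fun_on_def
proof (intro allI ballI, clarify)
  fix k U' z' assume c': "(U', z') \<in> \<A>"
  let ?S = "z' ` (U' \<inter> V')" and ?i = "inv_into U' z'"
  have S: "open ?S" using chart_open_image[OF c' assms(4)] .
  have lin: "bounded_linear (\<lambda>v. Re (c * v))"
    by (intro bounded_linear_compose[OF bounded_linear_Re bounded_linear_mult_right])
  have "holomorphic_Cn (f \<circ> ?i) (z' ` (U' \<inter> V))"
    using assms(5) c' unfolding holomorphic_fun_on_def by fast
  then have "holomorphic_Cn (f \<circ> ?i) ?S"
    by (rule holomorphic_Cn_subset) (use assms(3) in auto)
  then have 1: "Ck_on k (\<lambda>\<zeta>. Re (c * (f \<circ> ?i) \<zeta>)) ?S"
    by (intro Ck_on_bounded_linear[OF S lin] holomorphic_Cn_Ck_on[OF S])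
  have "holomorphic_Cn (\<lambda>\<zeta>. z (?i \<zeta>) $ i) (z' ` (U' \<inter> U))" for i
    using manifold c' assms(1) unfolding complex_manifold_def by fast
  then have "holomorphic_Cn (\<lambda>\<zeta>. z (?i \<zeta>) $ i) ?S" for i
    by (rule holomorphic_Cn_subset) (use assms(3) in auto)
  then have "Ck_on k (\<lambda>\<zeta>. z (?i \<zeta>)) ?S"
    by (intro Ck_on_vec[OF S] holomorphic_Cn_Ck_on[OF S])
  then have 2: "Ck_on k (\<lambda>\<zeta>. \<psi> (z (?i \<zeta>))) ?S"
    by (rule Ck_on_compose[OF S open_UNIV subset_UNIV assms(6)])
  show "Ck_on k ((\<lambda>y. Re (c * f y) + \<psi> (z y)) \<circ> ?i) ?S"
    using Ck_on_add[OF S 1 2] by (simp add: comp_def)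
qed

end

lemma compactin_attains_max:
  fixes g :: "'a \<Rightarrow> real"
  assumes "compactin Y K" "K \<noteq> {}" "continuous_map (subtopology Y K) euclidean g"
  obtains x where "x \<in> K" "\<And>y. y \<in> K \<Longrightarrow> g y \<le> g x"
proof -
  have "compactin (subtopology Y K) K" using assms(1) by (simp add: compactin_subtopology)
  from image_compactin[OF this assms(3)] have "compact (g ` K)" by simp
  then show ?thesis using compact_attains_sup[of "g ` K"] assms(2) that by blast
qed

section \<open>Local maxima of test perturbations\<close>

locale weakly_pseudoconcave_set = complex_manifold_charts X \<A>
  for X :: "'a topology" and \<A> :: "('a, 'n::finite) chart set" +
  fixes A :: "'a set" and q :: nat
  assumes subset: "A \<subseteq> topspace X" and locally_closed: "locally_closed_in X A"
    and pseudoconcave: "set_weakly_pseudoconcave X \<A> q A"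
begin

text \<open>A viscosity subsolution property: near \<open>x\<close> on \<open>A\<close>,
  \<open>cmod \<circ> f\<close> is never touched from above at \<open>x\<close> by a constant minus
  \<open>\<psi> \<circ> z\<close>.\<close>

definition no_test_maximum :: "('a \<Rightarrow> complex) \<Rightarrow> 'a \<Rightarrow> bool" where
  "no_test_maximum f x \<longleftrightarrow>
     (\<forall>U z \<psi> H N. (U, z) \<in> \<A> \<and> x \<in> U \<and> test_function \<psi> H \<and>
        int (num_pos_eigenvalues H) \<ge> int CARD('n) - int q + 1 \<and> openin X N \<and> x \<in> N \<longrightarrow>
        \<not> (\<forall>y\<in>A \<inter> N. cmod (f y) + \<psi> (z y) \<le> cmod (f x) + \<psi> (z x)))"

abbreviation "T \<equiv> subtopology X A"

lemma topspace_T: "topspace T = A"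
  using subset by auto

lemma no_test_maximumD:
  assumes "no_test_maximum f x" "(U, z) \<in> \<A>" "x \<in> U" "test_function \<psi> H"
    "int (num_pos_eigenvalues H) \<ge> int CARD('n) - int q + 1" "openin X N" "x \<in> N"
    "\<And>y. y \<in> A \<inter> N \<Longrightarrow> cmod (f y) + \<psi> (z y) \<le> cmod (f x) + \<psi> (z x)"
  shows False
  using assms unfolding no_test_maximum_def by blast

text \<open>Makes the property one of germs: the arbitrary neighbourhood \<open>N\<close> can be
  shrunk to where the two functions agree.\<close>

lemma no_test_maximum_cong:
  assumes "openin T W" "x \<in> W" "\<And>y. y \<in> W \<Longrightarrow> g y = f y" "no_test_maximum f x"
  shows "no_test_maximum g x"
  unfolding no_test_maximum_def
proof (intro allI impI notI, elim conjE)
  fix U z \<psi> H N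
  assume *: "(U, z) \<in> \<A>" "x \<in> U" "test_function \<psi> H"
    "int (num_pos_eigenvalues H) \<ge> int CARD('n) - int q + 1" and N: "openin X N" "x \<in> N"
    and max: "\<forall>y\<in>A \<inter> N. cmod (g y) + \<psi> (z y) \<le> cmod (g x) + \<psi> (z x)"
  obtain V where V: "openin X V" "W = V \<inter> A"
    using assms(1) unfolding openin_subtopology by blast
  show False
  proof (rule no_test_maximumD[OF assms(4) *])
    show "openin X (N \<inter> V)" "x \<in> N \<inter> V" using N V assms(2) by auto
    show "cmod (f y) + \<psi> (z y) \<le> cmod (f x) + \<psi> (z x)" if "y \<in> A \<inter> (N \<inter> V)" for y
    proof -
      have "y \<in> W" "y \<in> A \<inter> N" using that V(2) by auto
      then have "cmod (g y) + \<psi> (z y) \<le> cmod (g x) + \<psi> (z x)" using max by blast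
      then show ?thesis using assms(3)[OF assms(2)] assms(3)[OF \<open>y \<in> W\<close>] by simp
    qed
  qed
qed

text \<open>\<open>Re (c * f y)\<close> lies below \<open>cmod (f y)\<close> with equality at
  \<open>x\<close>, so it inherits the maximum. Unlike the modulus, it is smooth at zeros of
  \<open>f\<close> and pluriharmonic.\<close>

lemma holomorphic_no_test_maximum:
  assumes "x \<in> A" "openin X V" "x \<in> V" "holomorphic_fun_on \<A> V f"
  shows "no_test_maximum f x"
  unfolding no_test_maximum_def
proof (intro allI impI notI, elim conjE)
  fix U z \<psi> H N
  assume ch: "(U, z) \<in> \<A>" "x \<in> U" and \<psi>: "test_function \<psi> H"
    and H: "int (num_pos_eigenvalues H) \<ge> int CARD('n) - int q + 1" and N: "openin X N" "x \<in> N"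
    and max: "\<forall>y\<in>A \<inter> N. cmod (f y) + \<psi> (z y) \<le> cmod (f x) + \<psi> (z x)"
  \<comment> \<open>This also covers \<open>f x = 0\<close>, where the division gives \<open>c = 0\<close>.\<close>
  define c where "c = cnj (f x) / of_real (cmod (f x))"
  have "cmod c \<le> 1" by (simp add: c_def norm_divide)
  then have le: "Re (c * f y) \<le> cmod (f y)" for y
    using order_trans[OF complex_Re_le_cmod[of "c * f y"]] by (simp add: norm_mult mult_left_le_one_le)
  have "c * f x = of_real (cmod (f x))"
    using complex_norm_square[of "f x"]
    by (cases "f x = 0") (simp_all add: c_def mult.commute[of "cnj (f x)"] power2_eq_square divide_eq_eq)
  then have eq: "Re (c * f x) = cmod (f x)" by simp
  define \<phi> where "\<phi> = (\<lambda>y. Re (c * f y) + \<psi> (z y))"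
  define \<omega> where "\<omega> = V \<inter> U \<inter> N"
  have \<omega>: "openin X \<omega>" "x \<in> \<omega>" using assms(2,3) N ch chart(1)[OF ch(1)] by (auto simp: \<omega>_def)
  have \<psi>C: "Ck_on k \<psi> UNIV" for k using \<psi> by (simp add: test_function_def)
  have "smooth_fun_on \<A> \<omega> \<phi>"
    unfolding \<phi>_def by (rule smooth_fun_on_Re_holomorphic_add[OF ch(1) assms(2) _ \<omega>(1) assms(4) \<psi>C])
      (auto simp: \<omega>_def)
  moreover have "A \<inter> \<omega> \<subseteq> {y. \<phi> y \<le> \<phi> x}"
  proof
    fix y assume "y \<in> A \<inter> \<omega>"
    then have "cmod (f y) + \<psi> (z y) \<le> cmod (f x) + \<psi> (z x)" using max by (auto simp: \<omega>_def)
    then show "y \<in> {y. \<phi> y \<le> \<phi> x}" using le[of y] eq by (simp add: \<phi>_def)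
  qed
  \<comment> \<open>The Hessian is read in the chart \<open>z\<close> itself, where
    \<open>\<psi> \<circ> z\<close> becomes \<psi>, so no change of coordinates enters.\<close>
  moreover have "hessian_pos_eigenvalues_ge \<A> \<phi> x (int CARD('n) - int q + 1)"
  proof -
    let ?S = "z ` (U \<inter> V)"
    have S: "open ?S" "z x \<in> ?S" using chart_open_image[OF ch(1) assms(2)] assms(3) ch(2) by auto
    have hol: "holomorphic_Cn (f \<circ> inv_into U z) ?S"
      using assms(4) ch(1) unfolding holomorphic_fun_on_def by fast
    have "complex_hessian (\<phi> \<circ> inv_into U z) (z x) = complex_hessian \<psi> (z x)"
    proof (rule complex_hessian_add_Re_holomorphic[OF S hol Ck_on_subset[OF \<psi>C subset_UNIV]])
      show "(\<phi> \<circ> inv_into U z) w = Re (c * (f \<circ> inv_into U z) w) + \<psi> w" if "w \<in> ?S" for w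
      proof -
        have "z (inv_into U z w) = w" using that by (intro f_inv_into_f) auto
        then show ?thesis by (simp add: \<phi>_def)
      qed
    qed
    then have "complex_hessian (\<phi> \<circ> inv_into U z) (z x) = H" using \<psi> by (simp add: test_function_def)
    then show ?thesis using ch H unfolding hessian_pos_eigenvalues_ge_def by fastforce
  qed
  ultimately have "set_pseudoconvex_at X \<A> q A x"
    using \<omega> unfolding set_pseudoconvex_at_def by blast
  then show False using pseudoconcave assms(1) unfolding set_weakly_pseudoconcave_def by blast
qed

text \<open>The continuity clause puts these germs among \<open>continuous_germs\<close>, as
  \<open>approx_closure\<close> demands of the sets it intersects.\<close>

definition tame_germs :: "'a germ set" where
  "tame_germs = {germ_at T x f | x f. x \<in> A \<and> no_test_maximum f x \<and>
     (\<exists>U. openin T U \<and> x \<in> U \<and> continuous_map (subtopology T U) euclidean f)}"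

text \<open>Membership only gives some representative \<open>f\<close> of the germ. As
  \<open>g\<close> lies in its own germ, it agrees with \<open>f\<close> near \<open>x\<close> and
  inherits the property.\<close>

lemma tame_germsD:
  assumes "germ_at T x g \<in> tame_germs" "x \<in> A"
  shows "no_test_maximum g x"
proof -
  obtain f where f: "germ_at T x g = germ_at T x f" "no_test_maximum f x"
    using assms(1) unfolding tame_germs_def germ_at_def by auto
  have "g \<in> snd (germ_at T x g)"
    using assms(2) openin_topspace[of T] unfolding germ_at_def topspace_T by auto
  then obtain W where "openin T W" "x \<in> W" "\<forall>y\<in>W. g y = f y"
    unfolding f(1) by (auto simp: germ_at_def)
  then show ?thesis using no_test_maximum_cong[OF _ _ _ f(2)] by blast
qed

lemma holomorphic_germs_tame: "holomorphic_germs X \<A> A \<subseteq> tame_germs"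
proof
  fix \<gamma> assume "\<gamma> \<in> holomorphic_germs X \<A> A"
  then obtain x f V where g: "\<gamma> = germ_at T x f" "x \<in> A" "openin X V" "x \<in> V" "holomorphic_fun_on \<A> V f"
    unfolding holomorphic_germs_def by blast
  obtain U z where ch: "(U, z) \<in> \<A>" "x \<in> U" using chart_exists subset g(2) by blast
  have "holomorphic_Cn (f \<circ> inv_into U z) (z ` (U \<inter> V))"
    using g(5) ch(1) unfolding holomorphic_fun_on_def by fast
  then have "continuous_on (z ` (U \<inter> V)) (f \<circ> inv_into U z)"
    using Ck_on.simps(1) holomorphic_Cn_Ck_on[OF chart_open_image[OF ch(1) g(3)]] by blast
  then have "continuous_map (subtopology X (U \<inter> V)) euclidean f"
    by (intro chart_continuous[OF ch(1)]) auto
  then have "continuous_map (subtopology T (A \<inter> (U \<inter> V))) euclidean f"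
    by (auto simp: subtopology_subtopology intro: continuous_map_from_subtopology_mono)
  moreover have "openin T (A \<inter> (U \<inter> V))"
    using chart(1)[OF ch(1)] g(3) by (intro openin_subtopology_Int2) auto
  ultimately show "\<gamma> \<in> tame_germs"
    unfolding tame_germs_def using g ch holomorphic_no_test_maximum[OF g(2-5)] by blast
qed

text \<open>A local maximum of \<open>|f| + \<psi>\<close> at \<open>x\<close> is made strict by subtracting a small multiple of
  \<open>|z - z(x)|\<^sup>2\<close> from \<open>\<psi>\<close>. It then forces a local maximum of \<open>|h\<^sub>k| + \<psi>\<close>
  at some nearby point as soon as \<open>h\<^sub>k\<close> is uniformly close to \<open>f\<close>. This is the reason for
  considering only test functions with constant Hessian.\<close>

lemma no_test_maximum_uniform_limit:
  assumes "openin T U" "x \<in> U"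
    and h: "\<And>k::nat. h k \<in> sections T tame_germs U"
    and lim: "\<And>K. compactin T K \<Longrightarrow> K \<subseteq> U \<Longrightarrow> uniform_limit K h f sequentially"
  shows "no_test_maximum f x"
  unfolding no_test_maximum_def
proof (intro allI impI notI, elim conjE)
  fix V z \<psi> H N
  assume ch: "(V, z) \<in> \<A>" "x \<in> V" and \<psi>: "test_function \<psi> H"
    and H: "int (num_pos_eigenvalues H) \<ge> int CARD('n) - int q + 1" and N: "openin X N" "x \<in> N"
    and max: "\<forall>y\<in>A \<inter> N. cmod (f y) + \<psi> (z y) \<le> cmod (f x) + \<psi> (z x)"
  obtain W where W: "openin X W" "U = W \<inter> A"
    using assms(1) unfolding openin_subtopology by blast
  obtain O' C where C: "openin X O'" "closedin X C" "A = O' \<inter> C"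
    using locally_closed unfolding locally_closed_in_def by blast
  define G where "G = N \<inter> W \<inter> O'"
  have G: "openin X G" "x \<in> G" using N W C assms(2) by (auto simp: G_def)
  obtain r where r: "r > 0" "cball (z x) r \<subseteq> z ` (V \<inter> G)"
    using chart_open_image[OF ch(1) G(1)] G(2) ch(2) open_contains_cball[of "z ` (V \<inter> G)"] by blast
  \<comment> \<open>Intersecting with the closed set \<open>C\<close> instead of \<open>A\<close>
    gives compactness. Inside the chosen coordinate ball, which lies in \<open>O'\<close>, the two
    sets coincide; this is where local closedness enters.\<close>
  define K where "K = {y\<in>V. z y \<in> cball (z x) r} \<inter> C"
  have inG: "y \<in> G" if "y \<in> V" "z y \<in> cball (z x) r" for y
  proof -
    obtain y' where "y' \<in> V \<inter> G" "z y = z y'" using r(2) \<open>z y \<in> _\<close> by blast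
    then show ?thesis using that(1) inj_onD[OF chart(4)[OF ch(1)], of y y'] by auto
  qed
  have KA: "K = {y\<in>V. z y \<in> cball (z x) r} \<inter> A"
    using inG C(3) by (auto simp: K_def G_def)
  have KU: "K \<subseteq> U" and KN: "K \<subseteq> A \<inter> N" using inG W(2) by (auto simp: KA G_def)
  have xK: "x \<in> K" using ch(2) r(1) assms(2) W(2) by (simp add: KA)
  have "compactin X K" unfolding K_def
    by (intro compact_Int_closedin chart_compact_vimage[OF ch(1)] C(2)) (use r(2) in auto)
  then have Kc: "compactin T K" using KN by (simp add: compactin_subtopology)
  obtain d0 where d0: "d0 > 0"
    "\<And>d. 0 \<le> d \<Longrightarrow> d < d0 \<Longrightarrow> num_pos_eigenvalues (affine_matrix 1 d H) \<ge> num_pos_eigenvalues H"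
    using num_pos_eigenvalues_affine_matrix[of 1 H] by auto
  define d where "d = d0 / 2"
  have d: "d > 0" "d < d0" using d0(1) by (auto simp: d_def)
  define \<psi>' where "\<psi>' = (\<lambda>w. \<psi> w - d * (norm (w - z x))\<^sup>2)"
  have \<psi>': "test_function \<psi>' (affine_matrix 1 d H)"
    unfolding \<psi>'_def by (rule test_function_perturb[OF \<psi>])
  \<comment> \<open>On the sphere of radius \<open>r\<close> the perturbation lowers \<psi> by
    \<open>d * r\<^sup>2\<close>, four times \<eta>. Replacing \<open>f\<close> by
    \<open>h k\<close> at \<open>x\<close> and at a point of the sphere costs less than twice
    \<eta>, so the maximum over \<open>K\<close> cannot lie on the sphere.\<close>
  define \<eta> where "\<eta> = d * r\<^sup>2 / 4"
  have \<eta>: "\<eta> > 0" using d r(1) by (simp add: \<eta>_def)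
  have "\<forall>\<^sub>F k in sequentially. \<forall>y\<in>K. dist (h k y) (f y) < \<eta>"
    using lim[OF Kc KU] \<eta> unfolding uniform_limit_iff by blast
  then obtain k where k: "\<And>y. y \<in> K \<Longrightarrow> dist (h k y) (f y) < \<eta>"
    unfolding eventually_sequentially by blast
  have k': "\<bar>cmod (h k y) - cmod (f y)\<bar> < \<eta>" if "y \<in> K" for y
    using norm_triangle_ineq3[of "h k y" "f y"] k[OF that] by (simp add: dist_norm)
  have "continuous_map (subtopology T U) euclidean (h k)" using h[of k] by (simp add: sections_def)
  then have c1: "continuous_map (subtopology T K) euclidean (h k)"
    using KU by (rule continuous_map_from_subtopology_mono)
  have "continuous_map (subtopology X K) euclidean z"
    using chart_continuous_map[OF ch(1)] by (rule continuous_map_from_subtopology_mono) (auto simp: KA)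
  moreover have "subtopology X K = subtopology T K"
    using KN by (auto simp: subtopology_subtopology inf.absorb2)
  ultimately have c2: "continuous_map (subtopology T K) euclidean z" by simp
  have "continuous_map euclidean euclidean \<psi>'"
    using Ck_on_imp_continuous_on \<psi>' by (auto simp: test_function_def)
  from continuous_map_compose[OF c2 this]
  have c3: "continuous_map (subtopology T K) euclidean (\<lambda>y. \<psi>' (z y))" by (simp add: comp_def)
  have "continuous_map (subtopology T K) euclidean (\<lambda>y. cmod (h k y) + \<psi>' (z y))"
    by (intro continuous_map_add continuous_map_norm c1 c3)
  then obtain y where y: "y \<in> K" "\<And>y'. y' \<in> K \<Longrightarrow> cmod (h k y') + \<psi>' (z y') \<le> cmod (h k y) + \<psi>' (z y)"
    using compactin_attains_max[OF Kc] xK by blast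
  have "norm (z y - z x) < r"
  proof (rule ccontr)
    assume "\<not> norm (z y - z x) < r"
    then have "r\<^sup>2 \<le> (norm (z y - z x))\<^sup>2" using r(1) by (intro power_mono) auto
    then have "\<psi>' (z y) \<le> \<psi> (z y) - 4 * \<eta>" using d by (simp add: \<psi>'_def \<eta>_def)
    moreover have "cmod (f y) + \<psi> (z y) \<le> cmod (f x) + \<psi> (z x)" using max y(1) KN by blast
    moreover have "cmod (h k x) + \<psi> (z x) \<le> cmod (h k y) + \<psi>' (z y)"
      using y(2)[OF xK] by (simp add: \<psi>'_def)
    ultimately show False using k'[OF xK] k'[OF y(1)] \<eta> by linarith
  qed
  then have yb: "z y \<in> ball (z x) r" by (simp add: dist_norm norm_minus_commute)
  have yA: "y \<in> A" "y \<in> V" "y \<in> U" using y(1) KU by (auto simp: KA)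
  have "germ_at T y (h k) \<in> tame_germs" using h[of k] yA(3) by (simp add: sections_def)
  then have "no_test_maximum (h k) y" using yA(1) by (rule tame_germsD)
  \<comment> \<open>The maximum is attained at \<open>y\<close>, possibly different from
    \<open>x\<close>, but the constant Hessian carries the eigenvalue bound over. The open
    coordinate ball serves as neighbourhood, as its trace on \<open>A\<close> lies in
    \<open>K\<close>.\<close>
  then show False
  proof (rule no_test_maximumD[OF _ ch(1) yA(2) \<psi>'])
    show "int CARD('n) - int q + 1 \<le> int (num_pos_eigenvalues (affine_matrix 1 d H))"
      using H d0(2)[of d] d by linarith
    show "openin X {y \<in> V. z y \<in> ball (z x) r}" by (rule chart_open_vimage[OF ch(1) open_ball])
    show "y \<in> {y \<in> V. z y \<in> ball (z x) r}" using yb yA(2) by simp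
    show "cmod (h k y') + \<psi>' (z y') \<le> cmod (h k y) + \<psi>' (z y)"
      if "y' \<in> A \<inter> {y \<in> V. z y \<in> ball (z x) r}" for y'
      using that by (intro y(2)) (auto simp: KA)
  qed
qed

text \<open>\<open>LACR\<close> is an intersection of closed classes of germs, and the tame germs
  form one such class. No induction over iterated limits is needed.\<close>

lemma LACR_subset_tame_germs: "LACR X \<A> A \<subseteq> tame_germs"
proof -
  have "tame_germs \<subseteq> continuous_germs T"
    unfolding tame_germs_def continuous_germs_def by blast
  moreover have "approx_germs T tame_germs \<subseteq> tame_germs"
  proof
    fix \<gamma> assume "\<gamma> \<in> approx_germs T tame_germs"
    then obtain x f U h where g: "\<gamma> = germ_at T x f" "openin T U" "x \<in> U"
      "continuous_map (subtopology T U) euclidean f" "\<And>k::nat. h k \<in> sections T tame_germs U"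
      "\<And>K. compactin T K \<Longrightarrow> K \<subseteq> U \<Longrightarrow> uniform_limit K h f sequentially"
      unfolding approx_germs_def by blast
    have "x \<in> A" using openin_subset[OF g(2)] g(3) topspace_T by auto
    moreover have "no_test_maximum f x" by (rule no_test_maximum_uniform_limit[OF g(2,3,5,6)])
    ultimately show "\<gamma> \<in> tame_germs" unfolding tame_germs_def using g(1-4) by blast
  qed
  ultimately show ?thesis
    using holomorphic_germs_tame unfolding LACR_def approx_closure_def by (intro Inter_lower) blast
qed

lemma LACR_section_no_test_maximum:
  assumes "u \<in> sections T (LACR X \<A> A) D" "x \<in> D" "x \<in> A"
  shows "no_test_maximum u x"
  using assms LACR_subset_tame_germs by (intro tame_germsD) (auto simp: sections_def)

end

section \<open>The maximum modulus principle on relatively compact domains\<close>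

theorem theorem4p1:
  fixes X :: "'a topology" and \<A> :: "('a, 'n::finite) chart set"
    and A :: "'a set" and p q :: nat
  assumes "complex_manifold X \<A>"
    and "p \<ge> 1" and "q \<ge> 1"
    and "\<exists>\<rho>. Ck_fun_on \<A> 2 (topspace X) \<rho> \<and>
           (\<forall>x\<in>topspace X. hessian_pos_eigenvalues_ge \<A> \<rho> x (int CARD('n) - int p + 1))"
    and "A \<subseteq> topspace X" and "locally_closed_in X A"
    and "set_weakly_pseudoconcave X \<A> q A"
    and "q \<ge> p"
  shows "\<forall>D. rel_compact_domain (subtopology X A) D \<longrightarrow>
           (\<forall>u. u \<in> sections (subtopology X A) (LACR X \<A> A) D \<and>
                continuous_map (subtopology X (subtopology X A closure_of D)) euclidean u \<longrightarrow>
              (\<exists>m. is_max_on (\<lambda>x. cmod (u x)) (subtopology X A closure_of D) m \<and>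
                   is_max_on (\<lambda>x. cmod (u x)) (subtopology X A frontier_of D) m))"
proof (intro allI impI, elim conjE)
  interpret weakly_pseudoconcave_set X \<A> A q
    using assms by unfold_locales
  fix D u
  assume D: "rel_compact_domain T D" and u: "u \<in> sections T (LACR X \<A> A) D"
    and cont: "continuous_map (subtopology X (T closure_of D)) euclidean u"
  obtain \<rho> where \<rho>: "Ck_fun_on \<A> 2 (topspace X) \<rho>"
    "\<And>x. x \<in> topspace X \<Longrightarrow> hessian_pos_eigenvalues_ge \<A> \<rho> x (int CARD('n) - int p + 1)"
    using assms(4) by blast
  let ?cl = "T closure_of D" and ?fr = "T frontier_of D"
  have op: "openin T D" and ne: "D \<noteq> {}" and cpt: "compactin T ?cl"
    using D by (auto simp: rel_compact_domain_def)
  have DA: "D \<subseteq> A" using openin_subset[OF op] topspace_T by simp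
  have clA: "?cl \<subseteq> A" using closure_of_subset_topspace[of T D] topspace_T by simp
  have Dcl: "D \<subseteq> ?cl" using DA topspace_T by (intro closure_of_subset) simp
  have fr: "?fr = ?cl - D" using op by (simp add: frontier_of_def interior_of_openin)
  have sub: "subtopology T ?cl = subtopology X ?cl"
    using clA by (simp add: subtopology_subtopology inf.absorb2)
  have cu: "continuous_map (subtopology T ?cl) euclidean (\<lambda>x. cmod (u x))"
    unfolding sub using cont by (rule continuous_map_norm)
  have c\<rho>: "continuous_map (subtopology T ?cl) euclidean \<rho>"
    unfolding sub using Ck_fun_on_continuous[OF \<rho>(1)] by (rule continuous_map_from_subtopology)
  have cl_ne: "?cl \<noteq> {}" using ne Dcl by blast
  obtain x0 where x0: "x0 \<in> ?cl" "\<And>y. y \<in> ?cl \<Longrightarrow> cmod (u y) \<le> cmod (u x0)"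
    using compactin_attains_max[OF cpt cl_ne cu] by blast
  have "\<exists>y\<in>?fr. cmod (u y) = cmod (u x0)"
  proof (rule ccontr)
    assume "\<not> ?thesis"
    then have less: "cmod (u y) < cmod (u x0)" if "y \<in> ?fr" for y
      using x0(2)[of y] that fr by fastforce
    obtain m where m: "m < cmod (u x0)" "\<And>y. y \<in> ?fr \<Longrightarrow> cmod (u y) \<le> m"
    proof (cases "?fr = {}")
      case True
      then show thesis using that[of "cmod (u x0) - 1"] by simp
    next
      case False
      have "compactin T ?fr"
        using closed_compactin[OF cpt _ closedin_frontier_of] fr by blast
      moreover have "continuous_map (subtopology T ?fr) euclidean (\<lambda>x. cmod (u x))"
        using cu by (rule continuous_map_from_subtopology_mono) (auto simp: fr)
      ultimately obtain y where "y \<in> ?fr" "\<And>y'. y' \<in> ?fr \<Longrightarrow> cmod (u y') \<le> cmod (u y)"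
        using compactin_attains_max[OF _ False] by blast
      then show thesis using that[of "cmod (u y)"] less by blast
    qed
    obtain a where a: "\<And>y. y \<in> ?cl \<Longrightarrow> \<rho> y \<le> a"
      using compactin_attains_max[OF cpt cl_ne c\<rho>] by blast
    have "continuous_map (subtopology T ?cl) euclidean (\<lambda>x. - \<rho> x)"
      using c\<rho> by (rule continuous_map_minus)
    then obtain b where b: "\<And>y. y \<in> ?cl \<Longrightarrow> - \<rho> y \<le> b"
      using compactin_attains_max[OF cpt cl_ne] by blast
    \<comment> \<open>On the closure \<rho> varies by at most \<open>a + b\<close>, so adding
      \<open>e * \<rho>\<close> cannot bridge the gap between \<open>m\<close> and the maximum. The
      \<open>+ 1\<close> makes this strict and keeps the denominator positive.\<close>
    define e where "e = (cmod (u x0) - m) / (a + b + 1)"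
    have ab: "a + b + 1 > 0" using a[OF x0(1)] b[OF x0(1)] by linarith
    have e: "e > 0" and "e * (a + b + 1) = cmod (u x0) - m" using m(1) ab by (simp_all add: e_def)
    then have e': "e * a + e * b + e = cmod (u x0) - m" by (simp add: distrib_left)
    have "continuous_map (subtopology T ?cl) euclidean (\<lambda>x. cmod (u x) + e * \<rho> x)"
      by (intro continuous_map_add cu continuous_map_real_mult_left c\<rho>)
    then obtain x where x: "x \<in> ?cl" "\<And>y. y \<in> ?cl \<Longrightarrow> cmod (u y) + e * \<rho> y \<le> cmod (u x) + e * \<rho> x"
      using compactin_attains_max[OF cpt cl_ne] by blast
    have "x \<in> D"
    proof (rule ccontr)
      assume "x \<notin> D"
      then have "cmod (u x) \<le> m" using x(1) fr m(2) by blast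
      moreover have "e * \<rho> x \<le> e * a" "e * (- \<rho> x0) \<le> e * b"
        using a[OF x(1)] b[OF x0(1)] e by (intro mult_left_mono; simp)+
      ultimately show False using x(2)[OF x0(1)] e e' by simp
    qed
    then have xA: "x \<in> A" "x \<in> topspace X" using DA subset by auto
    from \<rho>(2)[OF xA(2)] obtain U z where ch: "(U, z) \<in> \<A>" "x \<in> U"
      and pos: "int (num_pos_eigenvalues (complex_hessian (\<rho> \<circ> inv_into U z) (z x))) \<ge> int CARD('n) - int p + 1"
      unfolding hessian_pos_eigenvalues_ge_def by blast
    have "U \<inter> topspace X = U" using openin_subset[OF chart(1)[OF ch(1)]] by blast
    then have C2: "Ck_on 2 (\<rho> \<circ> inv_into U z) (z ` U)"
      using \<rho>(1) ch(1) unfolding Ck_fun_on_def by fastforce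
    have inv: "inv_into U z (z y) = y" if "y \<in> U" for y
      using inv_into_f_f[OF chart(4)[OF ch(1)] that] .
    \<comment> \<open>\<psi> touches \<open>e * \<rho>\<close> from below at \<open>z x\<close>, so
      \<open>cmod (u y) + \<psi> (z y)\<close> is at most \<open>cmod (u y) + e * \<rho> y\<close>,
      with equality at \<open>x\<close>: the maximum persists locally.\<close>
    obtain \<psi> H r where \<psi>: "test_function \<psi> H"
        "num_pos_eigenvalues H \<ge> num_pos_eigenvalues (complex_hessian (\<rho> \<circ> inv_into U z) (z x))"
      and r: "r > 0" "\<psi> (z x) = e * (\<rho> \<circ> inv_into U z) (z x)"
        "\<And>w. w \<in> ball (z x) r \<Longrightarrow> \<psi> w \<le> e * (\<rho> \<circ> inv_into U z) w"
      using test_function_below[OF chart(2)[OF ch(1)] imageI[OF ch(2)] C2 e] by metis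
    obtain W where W: "openin X W" "D = W \<inter> A"
      using op unfolding openin_subtopology by blast
    have "no_test_maximum u x" by (rule LACR_section_no_test_maximum[OF u \<open>x \<in> D\<close> xA(1)])
    then show False
    proof (rule no_test_maximumD[OF _ ch \<psi>(1)])
      \<comment> \<open>Here \<open>p \<le> q\<close> is used: the bound for \<rho> in terms of
        \<open>p\<close> implies the one for test functions in terms of \<open>q\<close>.\<close>
      show "int CARD('n) - int q + 1 \<le> int (num_pos_eigenvalues H)"
        using pos \<psi>(2) assms(8) by linarith
      show "openin X ({y\<in>U. z y \<in> ball (z x) r} \<inter> W)"
        using chart_open_vimage[OF ch(1) open_ball] W(1) by blast
      show "x \<in> {y\<in>U. z y \<in> ball (z x) r} \<inter> W" using ch(2) r(1) \<open>x \<in> D\<close> W(2) by simp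
      fix y assume y: "y \<in> A \<inter> ({y\<in>U. z y \<in> ball (z x) r} \<inter> W)"
      then have "y \<in> ?cl" using W(2) Dcl by blast
      moreover have "\<psi> (z y) \<le> e * \<rho> y" using r(3)[of "z y"] y inv[of y] by simp
      ultimately show "cmod (u y) + \<psi> (z y) \<le> cmod (u x) + \<psi> (z x)"
        using x(2)[of y] r(2) inv[OF ch(2)] by simp
    qed
  qed
  then obtain y where y: "y \<in> ?fr" "cmod (u y) = cmod (u x0)" by blast
  show "\<exists>m. is_max_on (\<lambda>x. cmod (u x)) ?cl m \<and> is_max_on (\<lambda>x. cmod (u x)) ?fr m"
  proof (intro exI conjI)
    show "is_max_on (\<lambda>x. cmod (u x)) ?cl (cmod (u x0))"
      unfolding is_max_on_def using x0 by blast
    show "is_max_on (\<lambda>x. cmod (u x)) ?fr (cmod (u x0))"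
      unfolding is_max_on_def using x0(2) y fr by (metis DiffD1 imageI)
  qed
qed

end
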